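(* Consider the perturbed network $$\dot{x}_i = f_i(t,x_i)+\alpha\sum_{j=1}^n W_{ij}\,h(x_j-x_i),\qquad f_i(t,x_i)=f(t,x_i)+g_i(t,x_i),\qquad i\in\{1,\dots,n\},\ x_i\in\mathbb{R}^m,$$ fulfilling Assumptions A1, A2 and A3 (stated in the context), with symmetric Laplacian $L$, and the average synchronisation error $$e_s(t)=\frac{1}{n(n-1)}\sum_{i,j=1}^n\|x_i(t)-x_j(t)\|\quad\text{for all } t\ge t_0,$$ where the perturbations $g_i$ and the initial conditions $x_i(t_0)$, $i\in\{1,\dots,n\}$, are as in the persistence theorem (described in the context), with perturbation size $\epsilon_0$. Then whenever $\alpha\gamma=\alpha\beta\lambda_2>\rho$, one has $$\limsup_{t\to\infty} e_s(t)\le K\,\frac{\epsilon_0}{\alpha\beta\lambda_2-\rho},$$ where $K=K(\Gamma)$ is independent of the network size.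
   Context: $\mathbb{R}^m$ carries the Euclidean norm $\|\cdot\|$, and linear operators carry the induced operator norm. The function $f:\mathbb{R}\times\mathbb{R}^m\to\mathbb{R}^m$ describes the isolated node dynamics, the functions $g_i:\mathbb{R}\times\mathbb{R}^m\to\mathbb{R}^m$ are perturbations of it, $h:\mathbb{R}^m\to\mathbb{R}^m$ is the coupling function, $\alpha$ is the overall coupling strength, and $W=(W_{ij})_{i,j\in\{1,\dots,n\}}$ is the matrix describing the interaction structure of the network; $n$ is the network size. Put $V_i=\sum_{j=1}^n W_{ij}$ and let $V=\mathrm{diag}(V_1,\dots,V_n)$, taken to be positive definite. The Laplacian is $L=V-W$, with eigenvalues $\lambda_1,\dots,\lambda_n$, where $\lambda_1=0$ is the eigenvalue with eigenvector $\frac{1}{\sqrt n}(1,\dots,1)$. Since $L$ is symmetric, its spectrum is real and is ordered as $0=\lambda_1<\lambda_2\le\lambda_3\le\dots\le\lambda_n$. Assumption A1: $f$ is continuous, and there exists an inflowing invariant open ball $U\subset\mathbb{R}^m$ (inflowing invariant: at every boundary point of $U$ the vector field $f(t,\cdot)$ points strictly into $U$, for all $t$) such that $f$ is continuously differentiable in $U$ with $\|D_2 f(t,x)\|\le\varrho$ for all $t\in\mathbb{R}$ and $x\in U$, for some $\varrho>0$, where $D_2f$ is the Jacobian with respect to the second argument. Assumption A2: $h$ is continuously differentiable with $h(0)=0$. Put $\Gamma:=Dh(0)$ and denote the (complex) eigenvalues of $\Gamma$ by $\beta_1,\dots,\beta_m$. Assumption A3: $\gamma:=\min_{2\le i\le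 n,\ 1\le j\le m}\mathrm{Re}(\lambda_i\beta_j)>0$. Put $\beta:=\min_{i\in\{1,\dots,m\}}\mathrm{Re}\,\beta_i$; for symmetric $L$ this gives $\gamma=\beta\lambda_2$. Synchronisation constant $\rho$: the paper's synchronisation theorem states that, under A1–A3, there exists $\rho=\rho(f,\Gamma)$ such that for all $\alpha>\rho/\gamma$ the unperturbed network (all $g_i=0$) is locally uniformly synchronised, i.e. there exist $\delta>0$ and $C=C(L,\Gamma)>0$ such that if $x_i(t_0)\in U$ and $\|x_i(t_0)-x_j(t_0)\|\le\delta$ for any $i,j\in\{1,\dots,n\}$, then $\|x_i(t)-x_j(t)\|\le Ce^{-(\alpha\gamma-\rho)(t-t_0)}\|x_i(t_0)-x_j(t_0)\|$ for all $t\ge t_0$. The $\rho$ in the claim is this constant. Perturbations and initial conditions: the paper's persistence theorem states that if $\alpha>\rho/\gamma$, there exist $\delta>0$, $C>0$ and $\epsilon_g>0$ such that for all perturbations with $\|g_i(t,x)\|\le\epsilon_0\le\epsilon_g$ for all $t\in\mathbb{R}$, $x\in U$, $i\in\{1,\dots,n\}$, and all initial conditions $x_i(t_0)\in U$ with $\|x_i(t_0)-x_j(t_0)\|\le\delta$ for any $i,j\in\{1,\dots,n\}$, one has $\|x_i(t)-x_j(t)\|\le Ce^{-(\alpha\gamma-\rho)(t-t_0)}\|x_i(t_0)-x_j(t_0)\|+\frac{C\epsilon_0}{\alpha\gamma-\rho}$ for all $t\ge t_0$. The perturbations and initial conditions in the claim are those satisfying these conditions for such $\delta$ and $\epsilo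n_g$.
   Formalization: Solutions are required to stay in U unless the inflow on the boundary of U is bounded away from 0 uniformly in t (else false); ρ is some synchronisation constant, if one exists; decay estimates compare with the largest initial distance over all pairs instead of that of the same pair. *)

theory Defs
  imports "HOL-Analysis.Analysis" "Jordan_Normal_Form.Char_Poly"
begin

text \<open>The nodes of a network of size \<open>n\<close> are \<open>0, \<dots>, n - 1\<close>, following the indexing of matrices
  of dimension \<open>n \<times> n\<close>; the eigenvalues of its Laplacian are numbered \<open>lam 1, \<dots>, lam n\<close>. The state space
  of a node is \<^typ>\<open>real ^ 'm\<close>, and \<open>x i t\<close> is the state of node \<open>i\<close> at time \<open>t\<close>. The ball \<open>U\<close> is
  \<open>ball p r\<close>.\<close>

subsection \<open>Node dynamics and coupling function\<close>

definition inflowing :: "(real \<Rightarrow> real ^ 'm \<Rightarrow> real ^ 'm) \<Rightarrow> real ^ 'm \<Rightarrow> real \<Rightarrow> bool" where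
  "inflowing f p r \<longleftrightarrow> (\<forall>t. \<forall>x\<in>sphere p r. inner (f t x) (x - p) < 0)"

text \<open>For time-independent or time-periodic continuous \<open>f\<close> the following is equivalent to
  \<^const>\<open>inflowing\<close> by compactness of the sphere; in general the inflow may degenerate as
  time grows.\<close>

definition uniformly_inflowing :: "(real \<Rightarrow> real ^ 'm \<Rightarrow> real ^ 'm) \<Rightarrow> real ^ 'm \<Rightarrow> real \<Rightarrow> bool" where
  "uniformly_inflowing f p r \<longleftrightarrow>
     (\<exists>c>0. \<forall>t. \<forall>x\<in>sphere p r. inner (f t x) (x - p) \<le> - c)"

definition assumption_A1 :: "(real \<Rightarrow> real ^ 'm \<Rightarrow> real ^ 'm) \<Rightarrow> real ^ 'm \<Rightarrow> real \<Rightarrow> bool" where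
  "assumption_A1 f p r \<longleftrightarrow>
     continuous_on UNIV (\<lambda>(t, x). f t x) \<and> 0 < r \<and> inflowing f p r \<and>
     (\<exists>(D2 :: real \<Rightarrow> real ^ 'm \<Rightarrow> (real ^ 'm) \<Rightarrow>\<^sub>L (real ^ 'm)) \<rho>0.
        0 < \<rho>0 \<and>
        (\<forall>t. \<forall>x\<in>ball p r. (f t has_derivative blinfun_apply (D2 t x)) (at x)) \<and>
        (\<forall>t. continuous_on (ball p r) (D2 t)) \<and>
        (\<forall>t. \<forall>x\<in>ball p r. norm (D2 t x) \<le> \<rho>0))"

definition assumption_A2 :: "(real ^ 'm \<Rightarrow> real ^ 'm) \<Rightarrow> real ^ 'm ^ 'm \<Rightarrow> bool" where
  "assumption_A2 h \<Gamma> \<longleftrightarrow>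
     (\<exists>D :: real ^ 'm \<Rightarrow> (real ^ 'm) \<Rightarrow>\<^sub>L (real ^ 'm).
        (\<forall>x. (h has_derivative blinfun_apply (D x)) (at x)) \<and> continuous_on UNIV D) \<and>
     h 0 = 0 \<and> (h has_derivative (\<lambda>v. \<Gamma> *v v)) (at 0)"

definition complex_eigenvalues :: "real ^ 'm ^ 'm \<Rightarrow> complex set" where
  "complex_eigenvalues \<Gamma> =
     {z. \<exists>v :: complex ^ 'm. v \<noteq> 0 \<and> map_matrix complex_of_real \<Gamma> *v v = z *s v}"

definition beta_min :: "real ^ 'm ^ 'm \<Rightarrow> real" where
  "beta_min \<Gamma> = Min (Re ` complex_eigenvalues \<Gamma>)"

subsection \<open>Networks\<close>

definition degree_matrix :: "nat \<Rightarrow> real mat \<Rightarrow> real mat" where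
  "degree_matrix n W = mat_diag n (\<lambda>i. \<Sum>j<n. W $$ (i, j))"

definition laplacian :: "nat \<Rightarrow> real mat \<Rightarrow> real mat" where
  "laplacian n W = degree_matrix n W - W"

definition network :: "nat \<Rightarrow> real mat \<Rightarrow> bool" where
  "network n W \<longleftrightarrow> 2 \<le> n \<and> W \<in> carrier_mat n n \<and>
     (\<forall>v\<in>carrier_vec n. v \<noteq> 0\<^sub>v n \<longrightarrow> 0 < scalar_prod v (degree_matrix n W *\<^sub>v v))"

text \<open>\<open>lam 1, \<dots>, lam n\<close> lists the eigenvalues of \<open>L\<close> with multiplicity; \<open>lam 1 = 0\<close> belongs to the
  constant eigenvector.\<close>

definition laplacian_spectrum :: "nat \<Rightarrow> real mat \<Rightarrow> (nat \<Rightarrow> complex) \<Rightarrow> bool" where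
  "laplacian_spectrum n L lam \<longleftrightarrow>
     char_poly (map_mat complex_of_real L) = (\<Prod>i\<in>{1..n}. [:- lam i, 1:]) \<and> lam 1 = 0"

definition gamma_min :: "nat \<Rightarrow> (nat \<Rightarrow> complex) \<Rightarrow> real ^ 'm ^ 'm \<Rightarrow> real" where
  "gamma_min n lam \<Gamma> = Min ((\<lambda>(i, b). Re (lam i * b)) ` ({2..n} \<times> complex_eigenvalues \<Gamma>))"

definition network_solution ::
  "(real \<Rightarrow> real ^ 'm \<Rightarrow> real ^ 'm) \<Rightarrow> (nat \<Rightarrow> real \<Rightarrow> real ^ 'm \<Rightarrow> real ^ 'm) \<Rightarrow> nat \<Rightarrow> real mat \<Rightarrow>
   (real ^ 'm \<Rightarrow> real ^ 'm) \<Rightarrow> real \<Rightarrow> real \<Rightarrow> (nat \<Rightarrow> real \<Rightarrow> real ^ 'm) \<Rightarrow> bool" where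
  "network_solution f g n W h \<alpha> t0 x \<longleftrightarrow>
     (\<forall>i<n. \<forall>t\<ge>t0. (x i has_vector_derivative
        f t (x i t) + g i t (x i t)
          + \<alpha> *\<^sub>R (\<Sum>j<n. W $$ (i, j) *\<^sub>R h (x j t - x i t))) (at t within {t0..}))"

text \<open>If the inflow degenerates as time grows, arbitrarily small perturbations can drive the nodes
  out of the ball, where neither \<open>f\<close> nor the perturbations are controlled. The last conjunct
  excludes such solutions; it does not restrict anything when the inflow is uniform.\<close>

definition near_sync_solution ::
  "(real \<Rightarrow> real ^ 'm \<Rightarrow> real ^ 'm) \<Rightarrow> real ^ 'm \<Rightarrow> real \<Rightarrow>
   (nat \<Rightarrow> real \<Rightarrow> real ^ 'm \<Rightarrow> real ^ 'm) \<Rightarrow> nat \<Rightarrow> real mat \<Rightarrow>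
   (real ^ 'm \<Rightarrow> real ^ 'm) \<Rightarrow> real \<Rightarrow> real \<Rightarrow> real \<Rightarrow> (nat \<Rightarrow> real \<Rightarrow> real ^ 'm) \<Rightarrow> bool" where
  "near_sync_solution f p r g n W h \<alpha> \<delta> t0 x \<longleftrightarrow>
     network_solution f g n W h \<alpha> t0 x \<and>
     (\<forall>i<n. x i t0 \<in> ball p r) \<and>
     (\<forall>i<n. \<forall>j<n. norm (x i t0 - x j t0) \<le> \<delta>) \<and>
     (uniformly_inflowing f p r \<or> (\<forall>i<n. \<forall>t\<ge>t0. x i t \<in> ball p r))"

definition small_perturbation ::
  "real ^ 'm \<Rightarrow> real \<Rightarrow> nat \<Rightarrow> (nat \<Rightarrow> real \<Rightarrow> real ^ 'm \<Rightarrow> real ^ 'm) \<Rightarrow> real \<Rightarrow> bool" where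
  "small_perturbation p r n g \<epsilon> \<longleftrightarrow> (\<forall>i<n. \<forall>t. \<forall>y\<in>ball p r. norm (g i t y) \<le> \<epsilon>)"

subsection \<open>Synchronisation and persistence\<close>

text \<open>The decay estimates below compare with the largest initial distance between any two nodes.
  Comparing with the initial distance of the same pair would be wrong for \<open>n \<ge> 3\<close>: two nodes
  starting at the same point are separated by the influence of a third one.\<close>

definition spread :: "nat \<Rightarrow> (nat \<Rightarrow> real \<Rightarrow> real ^ 'm) \<Rightarrow> real \<Rightarrow> real" where
  "spread n x t = Max ((\<lambda>(i, j). norm (x i t - x j t)) ` ({..<n} \<times> {..<n}))"

text \<open>The factor \<open>C\<close> may depend on the Laplacian, but not on the coupling strength or on the
  coupling function beyond its derivative \<open>\<Gamma>\<close>; \<open>L\<close> need not be symmetric here.\<close>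

definition sync_constant ::
  "real ^ 'm ^ 'm \<Rightarrow> (real \<Rightarrow> real ^ 'm \<Rightarrow> real ^ 'm) \<Rightarrow> real ^ 'm \<Rightarrow> real \<Rightarrow> real \<Rightarrow> bool" where
  "sync_constant \<Gamma> f p r \<rho> \<longleftrightarrow>
     (\<forall>n L. \<exists>C>0. \<forall>W lam h \<alpha>.
        network n W \<and> laplacian n W = L \<and> laplacian_spectrum n L lam \<and> assumption_A2 h \<Gamma> \<and>
        0 < gamma_min n lam \<Gamma> \<and> \<alpha> > \<rho> / gamma_min n lam \<Gamma> \<longrightarrow>
        (\<exists>\<delta>>0. \<forall>t0 x. near_sync_solution f p r (\<lambda>_ _ _. 0) n W h \<alpha> \<delta> t0 x \<longrightarrow>
           (\<forall>i<n. \<forall>j<n. \<forall>t\<ge>t0. norm (x i t - x j t) \<le>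
              C * exp (- (\<alpha> * gamma_min n lam \<Gamma> - \<rho>) * (t - t0)) * spread n x t0)))"

text \<open>\<open>\<mu>\<close> stands for the synchronisation rate \<open>\<alpha> \<gamma> - \<rho>\<close>.\<close>

definition persistence_constants ::
  "(real \<Rightarrow> real ^ 'm \<Rightarrow> real ^ 'm) \<Rightarrow> real ^ 'm \<Rightarrow> real \<Rightarrow> nat \<Rightarrow> real mat \<Rightarrow>
   (real ^ 'm \<Rightarrow> real ^ 'm) \<Rightarrow> real \<Rightarrow> real \<Rightarrow> real \<Rightarrow> real \<Rightarrow> bool" where
  "persistence_constants f p r n W h \<alpha> \<mu> \<delta> \<epsilon>g \<longleftrightarrow>
     0 < \<delta> \<and> 0 < \<epsilon>g \<and>
     (\<exists>C>0. \<forall>g \<epsilon>0 t0 x.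
        \<epsilon>0 \<le> \<epsilon>g \<and> small_perturbation p r n g \<epsilon>0 \<and>
        near_sync_solution f p r g n W h \<alpha> \<delta> t0 x \<longrightarrow>
        (\<forall>i<n. \<forall>j<n. \<forall>t\<ge>t0. norm (x i t - x j t) \<le>
           C * exp (- \<mu> * (t - t0)) * spread n x t0 + C * \<epsilon>0 / \<mu>))"

definition average_sync_error :: "nat \<Rightarrow> (nat \<Rightarrow> real \<Rightarrow> real ^ 'm) \<Rightarrow> real \<Rightarrow> real" where
  "average_sync_error n x t =
     1 / (real n * (real n - 1)) * (\<Sum>i<n. \<Sum>j<n. norm (x i t - x j t))"

end

theory Submission
  imports Defs "Jordan_Normal_Form.Schur_Decomposition" "HOL-Real_Asymp.Real_Asymp"
begin

text \<open>The proof is a Lyapunov argument in a norm adapted to \<open>\<Gamma>\<close>. When \<open>\<beta>\<close>, the smallest real part of an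
  eigenvalue of \<open>\<Gamma>\<close>, is positive, a linear change of coordinates \<open>w\<close> turns \<open>\<Gamma>\<close> into a matrix whose diagonal
  has real parts at least \<open>\<beta>\<close> and whose other entries are tiny
  (\<open>nearly_diagonal_coordinates\<close>). On the deviations from the mean, a symmetric Laplacian is
  bounded below by its second eigenvalue (\<open>spectral_gap\<close>). Together the linear coupling
  \<open>\<alpha> L \<otimes> \<Gamma>\<close> contracts the deviations, in the adapted norm, at a rate of at least
  \<open>\<alpha> \<beta> \<lambda>\<^sub>2 / 2\<close> (\<open>coupling_coercive\<close>).

  Let \<open>V\<close> be the sum over the nodes of the squared adapted norm of the deviation. The Lipschitz constant
  of \<open>f\<close> reduces the rate by a term \<open>\<rho>\<^sub>1 / 2\<close> with \<open>\<rho>\<^sub>1\<close> depending on \<open>f\<close> and \<open>\<Gamma>\<close> only, which leaves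
  \<open>a = (\<alpha> \<beta> \<lambda>\<^sub>2 - \<rho>\<^sub>1) / 2\<close>. The nonlinearity of the coupling is negligible near synchrony, and the
  perturbation enters as a sum over the nodes; with \<open>k\<^sub>2\<close> the operator bound of \<open>w\<close>, this gives
  \<open>V' \<le> - a V + 2 n (k\<^sub>2 \<epsilon>)\<^sup>2 / a\<close> (\<open>disagreement_dissipation\<close>). Therefore the limit superior of
  \<open>V / n\<close> is at most \<open>2 (k\<^sub>2 \<epsilon> / a)\<^sup>2\<close>, and the average error is at most a constant times the square
  root of \<open>V / n\<close> (\<open>average_sync_error_le\<close>): this is why \<open>K\<close> does not depend on the size of the network.

  The loss of half of \<open>\<beta>\<close> is harmless. A synchronisation constant may be enlarged
  (\<open>sync_constant_mono\<close>), so that \<open>\<rho> \<ge> \<rho>\<^sub>1\<close> can be arranged; then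
  \<open>a \<ge> (\<alpha> \<beta> \<lambda>\<^sub>2 - \<rho>) / 2\<close>, and the factor two goes into \<open>K\<close>. Likewise the admissible initial
  distances and perturbation sizes may be decreased (\<open>persistence_constants_mono\<close>), so they can
  be taken small enough for the solution to remain in the ball and near synchrony
  (\<open>network_solution_trapped\<close>).\<close>

section \<open>Coordinates adapted to the coupling\<close>

text \<open>The Schur decomposition is used only through its left intertwiner \<open>Q\<close>: in the coordinates
  \<open>Q v\<close> the matrix \<open>A\<close> acts as a triangular one. The order of the list \<open>es\<close> is free, so a
  chosen eigenvalue can be put at the first diagonal position.\<close>

lemma schur_coordinates:
  fixes A :: "complex mat"
  assumes A: "A \<in> carrier_mat n n"
    and es: "char_poly A = (\<Prod>e\<leftarrow>es. [:- e, 1:])"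
  obtains B Q where "B \<in> carrier_mat n n" "Q \<in> carrier_mat n n" "upper_triangular B"
    "diag_mat B = es" "Q * A = B * Q"
    "\<And>v. v \<in> carrier_vec n \<Longrightarrow> Q *\<^sub>v v = 0\<^sub>v n \<Longrightarrow> v = 0\<^sub>v n"
proof -
  obtain B P Q where sd: "schur_decomposition A es = (B, P, Q)"
    by (cases "schur_decomposition A es") auto
  from schur_decomposition[OF A es sd]
  have wit: "similar_mat_wit A B P Q" and ut: "upper_triangular B" and dg: "diag_mat B = es"
    by auto
  note D = similar_mat_witD2[OF A wit]
  have "Q * A = Q * (P * (B * Q))"
    unfolding D(3) using D(5,6,7) by (simp add: assoc_mult_mat[of P n n B n Q n])
  also have "\<dots> = (Q * P) * (B * Q)"
    using D(5,6,7) by (simp add: assoc_mult_mat[of Q n n P n "B * Q" n])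
  finally have QA: "Q * A = B * Q" using D(2,5,7) by simp
  have "v = 0\<^sub>v n" if v: "v \<in> carrier_vec n" and Qv: "Q *\<^sub>v v = 0\<^sub>v n" for v
  proof -
    have "v = (P * Q) *\<^sub>v v" using D(1) v by simp
    also have "\<dots> = P *\<^sub>v (Q *\<^sub>v v)" using D(6,7) v by (simp add: assoc_mult_mat_vec[of P n n Q n])
    also have "\<dots> = 0\<^sub>v n" using D(6) unfolding Qv by (auto simp: scalar_prod_def)
    finally show ?thesis .
  qed
  with that[OF D(5,7) ut dg QA] show thesis by blast
qed

text \<open>Two matrix types meet here: matrices indexed by a finite type, which carry the topology, and
  matrices of explicit dimension, for which characteristic polynomials and triangularisation are
  developed. An enumeration \<open>e\<close> of the index type translates between them.\<close>

definition index_mat :: "(nat \<Rightarrow> 'm) \<Rightarrow> real ^ 'm ^ 'm \<Rightarrow> complex mat" where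
  "index_mat e \<Gamma> = mat CARD('m) CARD('m) (\<lambda>(i, j). complex_of_real (\<Gamma> $ e i $ e j))"

definition index_vec :: "(nat \<Rightarrow> 'm) \<Rightarrow> complex ^ 'm \<Rightarrow> complex vec" where
  "index_vec e v = vec CARD('m) (\<lambda>i. v $ e i)"

lemma index_carrier [simp]:
  fixes v :: "complex ^ 'm" and \<Gamma> :: "real ^ 'm ^ 'm"
  shows "index_mat e \<Gamma> \<in> carrier_mat CARD('m) CARD('m)" "index_vec e v \<in> carrier_vec CARD('m)"
  by (simp_all add: index_mat_def index_vec_def)

context
  fixes e :: "nat \<Rightarrow> 'm :: finite"
  assumes bij: "bij_betw e {..<CARD('m)} UNIV"
begin

lemma index_mat_mult:
  "index_mat e \<Gamma> *\<^sub>v index_vec e v = index_vec e (map_matrix complex_of_real \<Gamma> *v v)"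
proof (rule eq_vecI)
  fix i assume i: "i < dim_vec (index_vec e (map_matrix complex_of_real \<Gamma> *v v))"
  then have i: "i < CARD('m)" by (simp add: index_vec_def)
  have "vec_index (index_mat e \<Gamma> *\<^sub>v index_vec e v) i
      = (\<Sum>j<CARD('m). complex_of_real (\<Gamma> $ e i $ e j) * v $ e j)"
    using i by (simp add: index_mat_def index_vec_def scalar_prod_def lessThan_atLeast0)
  also have "\<dots> = (\<Sum>b\<in>UNIV. complex_of_real (\<Gamma> $ e i $ b) * v $ b)"
    by (rule sum.reindex_bij_betw[OF bij, of "\<lambda>b. complex_of_real (\<Gamma> $ e i $ b) * v $ b"])
  finally show "vec_index (index_mat e \<Gamma> *\<^sub>v index_vec e v) i
      = vec_index (index_vec e (map_matrix complex_of_real \<Gamma> *v v)) i"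
    using i by (simp add: index_vec_def matrix_vector_mult_def map_matrix_def)
qed (simp add: index_mat_def index_vec_def)

lemma index_vec_eq_iff: "index_vec e v = index_vec e u \<longleftrightarrow> v = u"
proof
  assume eq: "index_vec e v = index_vec e u"
  have "v $ a = u $ a" for a
  proof -
    obtain i where i: "i < CARD('m)" "a = e i"
      using bij by (auto simp: bij_betw_def image_iff)
    with arg_cong[OF eq, of "\<lambda>x. vec_index x i"] show ?thesis by (simp add: index_vec_def)
  qed
  then show "v = u" by (simp add: Finite_Cartesian_Product.vec_eq_iff)
qed simp

lemma index_vec_surj:
  assumes "u \<in> carrier_vec CARD('m)"
  shows "\<exists>v. u = index_vec e v"
proof -
  define v :: "complex ^ 'm" where "v = (\<chi> a. vec_index u (the_inv_into {..<CARD('m)} e a))"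
  have "u = index_vec e v"
  proof (rule eq_vecI)
    fix i assume "i < dim_vec (index_vec e v)"
    then have i: "i < CARD('m)" by (simp add: index_vec_def)
    then show "vec_index u i = vec_index (index_vec e v) i"
      using bij by (simp add: index_vec_def v_def bij_betw_def the_inv_into_f_f)
  qed (use assms in \<open>simp add: index_vec_def\<close>)
  then show ?thesis by blast
qed

lemma index_vec_0: "index_vec e 0 = 0\<^sub>v CARD('m)"
  by (auto simp: index_vec_def)

lemma complex_eigenvalues_index_mat:
  "complex_eigenvalues \<Gamma> = {z. eigenvalue (index_mat e \<Gamma>) z}"
proof -
  have smult: "index_vec e (z *s v) = z \<cdot>\<^sub>v index_vec e v" for z v
    by (auto simp: index_vec_def)
  have "eigenvalue (index_mat e \<Gamma>) z \<longleftrightarrow>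
      (\<exists>v. v \<noteq> 0 \<and> map_matrix complex_of_real \<Gamma> *v v = z *s v)" (is "_ \<longleftrightarrow> (\<exists>v. ?P v)") for z
  proof -
    have "eigenvector (index_mat e \<Gamma>) (index_vec e v) z \<longleftrightarrow> ?P v" for v
      using carrier_matD[OF index_carrier(1)[of e \<Gamma>]]
      by (simp add: eigenvector_def index_mat_mult smult[symmetric] index_vec_eq_iff
          index_vec_0[symmetric])
    moreover have "u \<in> carrier_vec CARD('m)" if "eigenvector (index_mat e \<Gamma>) u z" for u
      using that carrier_matD[OF index_carrier(1)[of e \<Gamma>]] by (simp add: eigenvector_def)
    ultimately show ?thesis
      unfolding eigenvalue_def using index_vec_surj by metis
  qed
  then show ?thesis by (simp add: complex_eigenvalues_def)
qed

end

lemma obtain_index: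
  obtains e :: "nat \<Rightarrow> 'm :: finite" where "bij_betw e {..<CARD('m)} UNIV"
  using ex_bij_betw_nat_finite[of "UNIV :: 'm set"] by (auto simp: lessThan_atLeast0)

lemma eigenvalues_eq_factors:
  fixes A :: "'a :: field mat"
  assumes "A \<in> carrier_mat n n" "char_poly A = (\<Prod>a\<leftarrow>es. [:- a, 1:])"
  shows "{z. eigenvalue A z} = set es"
proof -
  have "poly (\<Prod>a\<leftarrow>es. [:- a, 1:]) z = 0 \<longleftrightarrow> z \<in> set es" for z
    by (auto simp: poly_prod_list prod_list_zero_iff image_iff o_def)
  then show ?thesis using eigenvalue_root_char_poly[OF assms(1)] assms(2) by auto
qed

lemma complex_eigenvalues_finite_nonempty:
  fixes \<Gamma> :: "real ^ 'm ^ 'm"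
  shows "finite (complex_eigenvalues \<Gamma>)" "complex_eigenvalues \<Gamma> \<noteq> {}"
proof -
  obtain e :: "nat \<Rightarrow> 'm" where e: "bij_betw e {..<CARD('m)} UNIV" by (rule obtain_index)
  obtain es where es: "char_poly (index_mat e \<Gamma>) = (\<Prod>a\<leftarrow>es. [:- a, 1:])" "length es = CARD('m)"
    using char_poly_factorized[OF index_carrier(1)] by blast
  have "complex_eigenvalues \<Gamma> = set es"
    unfolding complex_eigenvalues_index_mat[OF e]
    by (rule eigenvalues_eq_factors[OF index_carrier(1) es(1)])
  with es(2) show "finite (complex_eigenvalues \<Gamma>)" "complex_eigenvalues \<Gamma> \<noteq> {}" by auto
qed

text \<open>Triangularise and rescale the \<open>k\<close>-th coordinate by \<open>s\<close> to the power \<open>- k\<close>: an entry above the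
  diagonal in row \<open>k\<close> and column \<open>l\<close> is multiplied by \<open>s\<close> to the power \<open>l - k\<close>, hence becomes as
  small as desired, while the diagonal keeps the eigenvalues. This replaces the Jordan form and
  makes the real part of the Hermitian form of \<open>\<Gamma>\<close> almost as large as the smallest real part of an
  eigenvalue, in a norm that depends only on \<open>\<Gamma>\<close>.\<close>

lemma nearly_diagonal_coordinates:
  fixes \<Gamma> :: "real ^ 'm ^ 'm"
  assumes b: "\<And>z. z \<in> complex_eigenvalues \<Gamma> \<Longrightarrow> b \<le> Re z" and \<eta>: "0 < \<eta>"
  obtains w :: "real ^ 'm \<Rightarrow> complex ^ 'm" and T :: "complex ^ 'm ^ 'm"
  where "linear w" "inj w" "\<And>v. w (\<Gamma> *v v) = T *v w v" "\<And>k. b \<le> Re (T $ k $ k)"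
    "\<And>k l. k \<noteq> l \<Longrightarrow> cmod (T $ k $ l) \<le> \<eta>"
proof -
  let ?m = "CARD('m)"
  obtain e :: "nat \<Rightarrow> 'm" where e: "bij_betw e {..<?m} UNIV" by (rule obtain_index)
  define A where "A = index_mat e \<Gamma>"
  have A: "A \<in> carrier_mat ?m ?m" by (simp add: A_def)
  obtain es where es: "char_poly A = (\<Prod>a\<leftarrow>es. [:- a, 1:])"
    using char_poly_factorized[OF A] by blast
  obtain B Q where B: "B \<in> carrier_mat ?m ?m" and Q: "Q \<in> carrier_mat ?m ?m"
    and ut: "upper_triangular B" and dg: "diag_mat B = es" and QA: "Q * A = B * Q"
    and Qinj: "\<And>v. v \<in> carrier_vec ?m \<Longrightarrow> Q *\<^sub>v v = 0\<^sub>v ?m \<Longrightarrow> v = 0\<^sub>v ?m"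
    by (rule schur_coordinates[OF A es]) blast
  define idx where "idx = the_inv_into {..<?m} e"
  have idx: "idx a < ?m" "e (idx a) = a" for a
    using e unfolding idx_def bij_betw_def
    by (metis UNIV_I lessThan_iff the_inv_into_into subset_refl,
        metis UNIV_I f_the_inv_into_f)
  have idx_e: "idx (e i) = i" if "i < ?m" for i
    using e that by (simp add: idx_def bij_betw_def the_inv_into_f_f)
  have Bdiag: "b \<le> Re (B $$ (i, i))" if "i < ?m" for i
  proof -
    have "B $$ (i, i) \<in> set es" using that B by (auto simp: dg[symmetric] diag_mat_def)
    also have "set es = complex_eigenvalues \<Gamma>"
      using eigenvalues_eq_factors[OF A es] complex_eigenvalues_index_mat[OF e, of \<Gamma>]
      by (simp add: A_def)
    finally show ?thesis by (rule b)
  qed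
  define M where "M = 1 + (\<Sum>i<?m. \<Sum>j<?m. cmod (B $$ (i, j)))"
  have BM: "cmod (B $$ (i, j)) \<le> M" if "i < ?m" "j < ?m" for i j
  proof -
    have "cmod (B $$ (i, j)) \<le> (\<Sum>j<?m. cmod (B $$ (i, j)))"
      using that by (intro member_le_sum) auto
    also have "\<dots> \<le> (\<Sum>i<?m. \<Sum>j<?m. cmod (B $$ (i, j)))"
      using that by (intro member_le_sum[of i _ "\<lambda>i. \<Sum>j<?m. cmod (B $$ (i, j))"]) (auto intro: sum_nonneg)
    finally show ?thesis by (simp add: M_def)
  qed
  have M: "1 \<le> M" by (auto simp: M_def intro!: sum_nonneg)
  \<comment> \<open>Every positive power of \<open>s\<close> is at most \<open>s\<close>, so it suffices that \<open>s * M\<close> is at most \<open>\<eta>\<close>.\<close>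
  define s where "s = min 1 (\<eta> / M)"
  have s: "0 < s" "s \<le> 1" "s * M \<le> \<eta>"
    using M \<eta> by (auto simp: s_def min_def field_simps)
  define c where "c v = index_vec e (\<chi> a. complex_of_real (v $ a))" for v :: "real ^ 'm"
  define w :: "real ^ 'm \<Rightarrow> complex ^ 'm" where
    "w v = (\<chi> k. complex_of_real (inverse s ^ idx k) * vec_index (Q *\<^sub>v c v) (idx k))" for v
  define T :: "complex ^ 'm ^ 'm" where
    "T = (\<chi> k l. complex_of_real (inverse s ^ idx k * s ^ idx l) * B $$ (idx k, idx l))"
  have cdim: "c v \<in> carrier_vec ?m" for v by (simp add: c_def)
  have Qc: "vec_index (Q *\<^sub>v c v) i = (\<Sum>j<?m. Q $$ (i, j) * complex_of_real (v $ e j))"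
    if "i < ?m" for i v
    using that Q by (simp add: c_def index_vec_def scalar_prod_def lessThan_atLeast0)
  have lin: "linear w"
    by (rule linearI; subst Finite_Cartesian_Product.vec_eq_iff)
      (simp_all add: w_def Qc idx algebra_simps sum.distrib sum_distrib_left
        scaleR_conv_of_real[where 'a = complex])
  have inj: "inj w"
  proof (subst linear_injective_0[OF lin], intro allI impI)
    fix v assume "w v = 0"
    then have "vec_index (Q *\<^sub>v c v) (idx k) = 0" for k
      using s(1) by (simp add: w_def Finite_Cartesian_Product.vec_eq_iff)
    then have "vec_index (Q *\<^sub>v c v) i = 0" if "i < ?m" for i
      using idx_e[OF that] by metis
    then have "Q *\<^sub>v c v = 0\<^sub>v ?m" using Q by (intro eq_vecI) auto
    then have "c v = index_vec e 0" using Qinj[OF cdim] index_vec_0[OF e] by simp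
    then show "v = 0" by (simp add: c_def index_vec_eq_iff[OF e] Finite_Cartesian_Product.vec_eq_iff)
  qed
  have c\<Gamma>: "c (\<Gamma> *v v) = A *\<^sub>v c v" for v
    unfolding c_def A_def index_mat_mult[OF e]
    by (rule arg_cong[of _ _ "index_vec e"])
      (simp add: Finite_Cartesian_Product.vec_eq_iff matrix_vector_mult_def map_matrix_def)
  have intertwine: "w (\<Gamma> *v v) = T *v w v" for v
  proof -
    have "Q *\<^sub>v c (\<Gamma> *v v) = (Q * A) *\<^sub>v c v"
      unfolding c\<Gamma> using assoc_mult_mat_vec[OF Q A cdim] by simp
    also have "\<dots> = B *\<^sub>v (Q *\<^sub>v c v)"
      unfolding QA using assoc_mult_mat_vec[OF B Q cdim] by simp
    finally have eq: "Q *\<^sub>v c (\<Gamma> *v v) = B *\<^sub>v (Q *\<^sub>v c v)" .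
    have "vec_index (Q *\<^sub>v c (\<Gamma> *v v)) i = (\<Sum>l\<in>UNIV. B $$ (i, idx l) * vec_index (Q *\<^sub>v c v) (idx l))"
      if "i < ?m" for i
    proof -
      have "vec_index (Q *\<^sub>v c (\<Gamma> *v v)) i = (\<Sum>j<?m. B $$ (i, j) * vec_index (Q *\<^sub>v c v) j)"
        unfolding eq using that B Q by (simp add: scalar_prod_def lessThan_atLeast0)
      also have "\<dots> = (\<Sum>j<?m. B $$ (i, idx (e j)) * vec_index (Q *\<^sub>v c v) (idx (e j)))"
        by (intro sum.cong) (simp_all add: idx_e)
      also have "\<dots> = (\<Sum>l\<in>UNIV. B $$ (i, idx l) * vec_index (Q *\<^sub>v c v) (idx l))"
        by (rule sum.reindex_bij_betw[OF e, of "\<lambda>l. B $$ (i, idx l) * vec_index (Q *\<^sub>v c v) (idx l)"])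
      finally show ?thesis .
    qed
    then have row: "w (\<Gamma> *v v) $ k = (\<Sum>l\<in>UNIV. complex_of_real (inverse s ^ idx k) *
        (B $$ (idx k, idx l) * vec_index (Q *\<^sub>v c v) (idx l)))" for k
      by (simp add: w_def idx sum_distrib_left)
    have "(T *v w v) $ k = (\<Sum>l\<in>UNIV. T $ k $ l * w v $ l)" for k
      by (simp add: matrix_vector_mult_def)
    also have "\<dots> k = (\<Sum>l\<in>UNIV. complex_of_real (inverse s ^ idx k) *
        (B $$ (idx k, idx l) * vec_index (Q *\<^sub>v c v) (idx l)))" for k
      using s(1) by (intro sum.cong refl) (simp add: T_def w_def power_inverse field_simps)
    finally have "w (\<Gamma> *v v) $ k = (T *v w v) $ k" for k by (simp only: row)
    then show ?thesis by (simp add: Finite_Cartesian_Product.vec_eq_iff)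
  qed
  have diag: "b \<le> Re (T $ k $ k)" for k
    using Bdiag[OF idx(1)] s(1) by (simp add: T_def power_inverse)
  have off: "cmod (T $ k $ l) \<le> \<eta>" if kl: "k \<noteq> l" for k l
  proof (cases "idx k < idx l")
    case True
    have "inverse s ^ idx k * s ^ idx l = s ^ (idx l - idx k)"
      using s(1) True by (simp add: power_inverse power_diff field_simps)
    also have "\<dots> \<le> s" using s True power_decreasing[of 1 "idx l - idx k" s] by simp
    finally have "inverse s ^ idx k * s ^ idx l * cmod (B $$ (idx k, idx l)) \<le> s * M"
      using BM[OF idx(1) idx(1)] s(1) by (intro mult_mono) auto
    then show ?thesis using s by (simp add: T_def norm_mult norm_power norm_inverse)
  next
    case False
    with kl have "idx l < idx k" using idx(2) by (metis linorder_neqE_nat)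
    then have "B $$ (idx k, idx l) = 0" using ut B idx(1)[of k] by (auto simp: upper_triangular_def)
    then show ?thesis using \<eta> by (simp add: T_def)
  qed
  from that[OF lin inj intertwine diag off] show thesis by blast
qed

section \<open>The spectral gap of a symmetric Laplacian\<close>

text \<open>The size of the network is a number, not a type, so signals on it are functions on the natural
  numbers that vanish from \<open>n\<close> on; the set lies in a product of compact intervals, which is compact
  in the product topology.\<close>

lemma compact_unit_sphere_zero_sum:
  fixes n :: nat
  defines "S \<equiv> {v :: nat \<Rightarrow> real. (\<forall>i\<ge>n. v i = 0) \<and> (\<Sum>i<n. (v i)\<^sup>2) = 1 \<and> (\<Sum>i<n. v i) = 0}"
  shows "compact S"
proof -
  define C where "C i = (if i < n then {-1..1::real} else {0})" for i
  have "compactin (product_topology (\<lambda>i::nat. euclidean) UNIV) (PiE UNIV C)"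
    by (subst compactin_PiE) (auto simp: C_def)
  then have cC: "compact (PiE UNIV C)" by (simp add: euclidean_product_topology)
  have "closed S"
  proof -
    have "S = (\<Inter>i\<in>{n..}. {v. v i = 0}) \<inter> {v. (\<Sum>i<n. (v i)\<^sup>2) = 1} \<inter> {v. (\<Sum>i<n. v i) = 0}"
      by (auto simp: S_def)
    then show ?thesis
      by (auto intro!: closed_Int closed_INT closed_Collect_eq continuous_intros)
  qed
  moreover have "S \<subseteq> PiE UNIV C"
  proof
    fix v assume v: "v \<in> S"
    have "\<bar>v i\<bar> \<le> 1" if "i < n" for i
    proof -
      have "(v i)\<^sup>2 \<le> (\<Sum>i<n. (v i)\<^sup>2)" using that by (intro member_le_sum) auto
      then show ?thesis using v by (simp add: S_def abs_square_le_1)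
    qed
    then show "v \<in> PiE UNIV C" using v by (force simp: C_def S_def abs_le_iff)
  qed
  ultimately show ?thesis using cC by (metis compact_Int_closed inf.absorb_iff2)
qed

definition qform :: "nat \<Rightarrow> real mat \<Rightarrow> (nat \<Rightarrow> real) \<Rightarrow> (nat \<Rightarrow> real) \<Rightarrow> real" where
  "qform n L u v = (\<Sum>i<n. \<Sum>j<n. L $$ (i, j) * u i * v j)"

lemma qform_sym:
  assumes "\<And>i j. i < n \<Longrightarrow> j < n \<Longrightarrow> L $$ (i, j) = L $$ (j, i)"
  shows "qform n L u v = qform n L v u"
proof -
  have "qform n L u v = (\<Sum>j<n. \<Sum>i<n. L $$ (i, j) * u i * v j)"
    unfolding qform_def by (rule sum.swap)
  also have "\<dots> = qform n L v u"
    unfolding qform_def using assms by (intro sum.cong refl) (simp add: mult_ac)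
  finally show ?thesis .
qed

lemma qform_add_scaled:
  assumes "\<And>i j. i < n \<Longrightarrow> j < n \<Longrightarrow> L $$ (i, j) = L $$ (j, i)"
  shows "qform n L (\<lambda>i. u i + t * y i) (\<lambda>i. u i + t * y i)
    = qform n L u u + 2 * t * qform n L u y + t\<^sup>2 * qform n L y y"
proof -
  have "qform n L (\<lambda>i. u i + t * y i) (\<lambda>i. u i + t * y i)
      = qform n L u u + t * qform n L u y + t * qform n L y u + t\<^sup>2 * qform n L y y"
    by (simp add: qform_def sum.distrib sum_distrib_left algebra_simps power2_eq_square)
  then show ?thesis using qform_sym[OF assms, of n y u] by simp
qed

lemma nonneg_parabola_linear_coeff_0:
  fixes b c :: real
  assumes "\<And>t. 0 \<le> 2 * t * b + t\<^sup>2 * c"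
  shows "b = 0"
proof (rule ccontr)
  assume b: "b \<noteq> 0"
  define k where "k = \<bar>c\<bar> + 1"
  have k: "0 < k" "c < 2 * k" by (auto simp: k_def)
  \<comment> \<open>A step against the sign of \<open>b\<close>, short enough for the linear term to dominate.\<close>
  have "0 \<le> 2 * (- (b / k)) * b + (- (b / k))\<^sup>2 * c" by (rule assms)
  also have "\<dots> = (b / k)\<^sup>2 * (c - 2 * k)"
    using k(1) by (simp add: field_simps power2_eq_square)
  also have "\<dots> < 0" using b k by (intro mult_pos_neg) auto
  finally show False by simp
qed

text \<open>Perturbing a minimiser \<open>u\<close> of the quadratic form in a direction \<open>y\<close> with zero sum shows that
  \<open>L u - \<mu> u\<close> is orthogonal to \<open>y\<close>. As the rows and columns of \<open>L\<close> have zero sum, \<open>L u - \<mu> u\<close> is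
  itself such a direction, hence zero.\<close>

lemma rayleigh_minimiser:
  assumes n: "2 \<le> n"
    and sym: "\<And>i j. i < n \<Longrightarrow> j < n \<Longrightarrow> L $$ (i, j) = L $$ (j, i)"
    and rows: "\<And>i. i < n \<Longrightarrow> (\<Sum>j<n. L $$ (i, j)) = 0"
  obtains u \<mu> where "(\<Sum>i<n. (u i)\<^sup>2) = 1" "(\<Sum>i<n. u i) = 0"
    "\<And>i. i < n \<Longrightarrow> (\<Sum>j<n. L $$ (i, j) * u j) = \<mu> * u i"
    "\<And>v. (\<Sum>i<n. v i) = 0 \<Longrightarrow> \<mu> * (\<Sum>i<n. (v i)\<^sup>2) \<le> qform n L v v"
proof -
  define S where "S = {v :: nat \<Rightarrow> real. (\<forall>i\<ge>n. v i = 0) \<and> (\<Sum>i<n. (v i)\<^sup>2) = 1 \<and> (\<Sum>i<n. v i) = 0}"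
  define s where "s v = (\<Sum>i<n. (v i)\<^sup>2)" for v :: "nat \<Rightarrow> real"
  have "compact S" unfolding S_def by (rule compact_unit_sphere_zero_sum)
  moreover have "S \<noteq> {}"
  proof -
    define v :: "nat \<Rightarrow> real" where "v i = (if i = 0 then 1 / sqrt 2 else if i = 1 then - 1 / sqrt 2 else 0)" for i
    have "(\<Sum>i<n. (v i)\<^sup>2) = (\<Sum>i\<in>{0,1}. (v i)\<^sup>2)"
      by (rule sum.mono_neutral_right) (use n in \<open>auto simp: v_def\<close>)
    moreover have "(\<Sum>i<n. v i) = (\<Sum>i\<in>{0,1}. v i)"
      by (rule sum.mono_neutral_right) (use n in \<open>auto simp: v_def\<close>)
    ultimately have "v \<in> S" using n by (auto simp: S_def v_def power_divide)
    then show ?thesis by blast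
  qed
  moreover have "continuous_on S (\<lambda>v. qform n L v v)"
    unfolding qform_def
    by (intro continuous_intros continuous_on_subset[OF continuous_on_product_coordinates]) auto
  ultimately obtain u where u: "u \<in> S" "\<And>v. v \<in> S \<Longrightarrow> qform n L u u \<le> qform n L v v"
    using continuous_attains_inf[of S "\<lambda>v. qform n L v v"] by blast
  define \<mu> where "\<mu> = qform n L u u"
  have su: "s u = 1" and zu: "(\<Sum>i<n. u i) = 0" using u(1) by (auto simp: S_def s_def)
  have min: "\<mu> * s v \<le> qform n L v v" if v: "(\<Sum>i<n. v i) = 0" for v
  proof (cases "s v = 0")
    case True
    then have "\<And>i. i < n \<Longrightarrow> v i = 0" by (simp add: s_def sum_nonneg_eq_0_iff)
    then show ?thesis using True by (simp add: qform_def)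
  next
    case False
    moreover have "0 \<le> s v" by (simp add: s_def sum_nonneg)
    ultimately have pos: "0 < s v" by simp
    define v' where "v' i = (if i < n then v i / sqrt (s v) else 0)" for i
    have "(\<Sum>i<n. (v' i)\<^sup>2) = (\<Sum>i<n. (v i)\<^sup>2) / s v"
      using pos by (simp add: v'_def power_divide sum_divide_distrib)
    moreover have "(\<Sum>i<n. v' i) = (\<Sum>i<n. v i) / sqrt (s v)"
      by (simp add: v'_def sum_divide_distrib)
    ultimately have "v' \<in> S" using pos v by (simp add: S_def s_def[symmetric]) (simp add: v'_def)
    then have "\<mu> \<le> qform n L v' v'" using u(2) by (simp add: \<mu>_def)
    also have "\<dots> = (\<Sum>i<n. \<Sum>j<n. L $$ (i, j) * v i * v j / s v)"
      unfolding qform_def using pos by (intro sum.cong refl) (simp add: v'_def)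
    also have "\<dots> = qform n L v v / s v"
      by (simp add: qform_def sum_divide_distrib)
    finally show ?thesis using pos by (simp add: field_simps)
  qed
  define r where "r i = (\<Sum>j<n. L $$ (i, j) * u j) - \<mu> * u i" for i
  have sum_r: "(\<Sum>i<n. r i) = 0"
  proof -
    have "(\<Sum>i<n. \<Sum>j<n. L $$ (i, j) * u j) = (\<Sum>j<n. \<Sum>i<n. L $$ (i, j) * u j)"
      by (rule sum.swap)
    also have "\<dots> = (\<Sum>j<n. (\<Sum>i<n. L $$ (j, i)) * u j)"
      using sym by (intro sum.cong refl) (simp add: sum_distrib_right)
    also have "\<dots> = 0" using rows by simp
    finally show ?thesis using zu by (simp add: r_def sum_subtractf sum_distrib_left[symmetric])
  qed
  have "(\<Sum>i<n. r i * r i) = 0"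
  proof -
    have "qform n L u r - \<mu> * (\<Sum>i<n. u i * r i) = 0"
    proof (rule nonneg_parabola_linear_coeff_0)
      fix t :: real
      have zero: "(\<Sum>i<n. u i + t * r i) = 0"
        using zu sum_r by (simp add: sum.distrib sum_distrib_left[symmetric])
      have "s (\<lambda>i. u i + t * r i) = s u + 2 * t * (\<Sum>i<n. u i * r i) + t\<^sup>2 * s r"
        by (simp add: s_def sum.distrib sum_distrib_left algebra_simps power2_eq_square)
      with min[OF zero] show "0 \<le> 2 * t * (qform n L u r - \<mu> * (\<Sum>i<n. u i * r i))
          + t\<^sup>2 * (qform n L r r - \<mu> * s r)"
        using qform_add_scaled[OF sym, of n u t r] su \<mu>_def by (simp add: algebra_simps)
    qed
    moreover have "(\<Sum>i<n. r i * r i) = qform n L r u - \<mu> * (\<Sum>i<n. u i * r i)"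
    proof -
      have "(\<Sum>i<n. r i * r i) = (\<Sum>i<n. r i * (\<Sum>j<n. L $$ (i, j) * u j) - \<mu> * (u i * r i))"
        by (intro sum.cong refl) (subst (2) r_def, simp add: algebra_simps)
      then show ?thesis
        by (simp add: qform_def sum_subtractf sum_distrib_left mult_ac)
    qed
    ultimately show ?thesis using qform_sym[OF sym, of n u r] by simp
  qed
  then have "\<forall>i\<in>{..<n}. r i * r i = 0" by (subst (asm) sum_nonneg_eq_0_iff) auto
  then have "(\<Sum>j<n. L $$ (i, j) * u j) = \<mu> * u i" if "i < n" for i
    using that by (force simp: r_def)
  with that[of u \<mu>] su zu min show thesis by (simp add: s_def)
qed

text \<open>Back substitution, starting with the last row.\<close>

lemma upper_triangular_kernel:
  fixes B :: "'a :: field mat"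
  assumes B: "B \<in> carrier_mat n n" and ut: "upper_triangular B"
    and diag: "\<And>i. 0 < i \<Longrightarrow> i < n \<Longrightarrow> B $$ (i, i) \<noteq> 0"
    and v: "v \<in> carrier_vec n" and Bv: "B *\<^sub>v v = 0\<^sub>v n"
    and i: "0 < i" "i < n"
  shows "vec_index v i = 0"
  using i
proof (induction "n - i" arbitrary: i rule: less_induct)
  case less
  have "0 = (\<Sum>j<n. B $$ (i, j) * vec_index v j)"
    using arg_cong[OF Bv, of "\<lambda>x. vec_index x i"] less.prems B v
    by (simp add: scalar_prod_def lessThan_atLeast0)
  also have "\<dots> = (\<Sum>j<n. if j = i then B $$ (i, i) * vec_index v i else 0)"
  proof (rule sum.cong[OF refl])
    fix j assume j: "j \<in> {..<n}"
    consider "j < i" | "j = i" | "i < j" by linarith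
    then show "B $$ (i, j) * vec_index v j = (if j = i then B $$ (i, i) * vec_index v i else 0)"
    proof cases
      case 1
      then show ?thesis using ut B less.prems by (auto simp: upper_triangular_def)
    next
      case 3
      then have "vec_index v j = 0" using less.hyps[of j] less.prems j by auto
      then show ?thesis using 3 by simp
    qed simp
  qed
  also have "\<dots> = B $$ (i, i) * vec_index v i" using less.prems by simp
  finally show ?case using diag[OF less.prems] by simp
qed

text \<open>Listing the zero eigenvalue first makes the triangular form nonsingular below the first row, so
  back substitution leaves a kernel vector only its first coordinate. This bounds the geometric by
  the algebraic multiplicity.\<close>

lemma simple_zero_eigenvalue_kernel:
  fixes A :: "complex mat"
  assumes n: "0 < n" and A: "A \<in> carrier_mat n n"
    and es: "char_poly A = (\<Prod>i\<in>{1..n}. [:- lam i, 1:])"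
    and nz: "\<And>i. 2 \<le> i \<Longrightarrow> i \<le> n \<Longrightarrow> lam i \<noteq> 0"
    and u: "u \<in> carrier_vec n" "A *\<^sub>v u = 0\<^sub>v n"
    and v: "v \<in> carrier_vec n" "A *\<^sub>v v = 0\<^sub>v n" "v \<noteq> 0\<^sub>v n"
  obtains c where "u = c \<cdot>\<^sub>v v"
proof -
  have "char_poly A = (\<Prod>a\<leftarrow>map lam [1..<Suc n]. [:- a, 1:])"
    using prod.distinct_set_conv_list[of "[1..<Suc n]" "\<lambda>i. [:- lam i, 1:]"]
    by (simp add: es o_def atLeastLessThanSuc_atLeastAtMost del: upt_Suc)
  from schur_coordinates[OF A this]
  obtain B Q where B: "B \<in> carrier_mat n n" and Q: "Q \<in> carrier_mat n n"
    and ut: "upper_triangular B" and dg: "diag_mat B = map lam [1..<Suc n]" and QA: "Q * A = B * Q"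
    and Qinj: "\<And>v. v \<in> carrier_vec n \<Longrightarrow> Q *\<^sub>v v = 0\<^sub>v n \<Longrightarrow> v = 0\<^sub>v n"
    by metis
  have diag: "B $$ (i, i) \<noteq> 0" if "0 < i" "i < n" for i
  proof -
    have "B $$ (i, i) = diag_mat B ! i" using B that by (simp add: diag_mat_def)
    also have "\<dots> = lam (Suc i)" using that by (simp add: dg del: upt_Suc)
    finally show ?thesis using nz[of "Suc i"] that by simp
  qed
  have ker: "vec_index (Q *\<^sub>v x) i = 0" if x: "x \<in> carrier_vec n" "A *\<^sub>v x = 0\<^sub>v n" and i: "0 < i" "i < n" for x i
  proof (rule upper_triangular_kernel[OF B ut diag _ _ i])
    have "B *\<^sub>v (Q *\<^sub>v x) = Q *\<^sub>v (A *\<^sub>v x)"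
      using assoc_mult_mat_vec[OF B Q x(1)] assoc_mult_mat_vec[OF Q A x(1)] QA by simp
    then show "B *\<^sub>v (Q *\<^sub>v x) = 0\<^sub>v n" using x(2) Q by (auto simp: scalar_prod_def)
  qed (use Q x in auto)
  define a where "a = vec_index (Q *\<^sub>v u) 0"
  define b where "b = vec_index (Q *\<^sub>v v) 0"
  have b: "b \<noteq> 0"
  proof
    assume "b = 0"
    then have "Q *\<^sub>v v = 0\<^sub>v n"
      using ker[OF v(1,2)] Q by (intro eq_vecI) (auto simp: b_def, metis neq0_conv)
    then show False using Qinj[OF v(1)] v(3) by simp
  qed
  have "Q *\<^sub>v (b \<cdot>\<^sub>v u - a \<cdot>\<^sub>v v) = b \<cdot>\<^sub>v (Q *\<^sub>v u) - a \<cdot>\<^sub>v (Q *\<^sub>v v)"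
    using Q u v by (simp add: mult_minus_distrib_mat_vec mult_mat_vec)
  also have "\<dots> = 0\<^sub>v n"
  proof (rule eq_vecI)
    fix i assume "i < dim_vec (0\<^sub>v n)"
    then have i: "i < n" by simp
    show "vec_index (b \<cdot>\<^sub>v (Q *\<^sub>v u) - a \<cdot>\<^sub>v (Q *\<^sub>v v)) i = vec_index (0\<^sub>v n) i"
      using ker[OF u, of i] ker[OF v(1,2), of i] i Q
      by (cases "i = 0") (simp_all add: a_def b_def)
  qed (use Q in simp)
  finally have zero: "b \<cdot>\<^sub>v u - a \<cdot>\<^sub>v v = 0\<^sub>v n" using Qinj u v by auto
  have "u = (a / b) \<cdot>\<^sub>v v"
  proof (rule eq_vecI)
    fix i assume "i < dim_vec ((a / b) \<cdot>\<^sub>v v)"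
    then have i: "i < n" using v by simp
    from arg_cong[OF zero, of "\<lambda>x. vec_index x i"] i u v
    have "b * vec_index u i = a * vec_index v i" by simp
    then show "vec_index u i = vec_index ((a / b) \<cdot>\<^sub>v v) i" using i v b by (simp add: field_simps)
  qed (use u v in simp)
  then show thesis by (rule that)
qed

text \<open>The minimum of the Rayleigh quotient over signals with zero sum is an eigenvalue. It is not zero:
  the zero eigenvalue is simple and its eigenvector, the constant one, does not have zero sum.
  So it is at least the second eigenvalue.\<close>

lemma spectral_gap:
  assumes n: "2 \<le> n" and L: "L \<in> carrier_mat n n"
    and sym: "\<And>i j. i < n \<Longrightarrow> j < n \<Longrightarrow> L $$ (i, j) = L $$ (j, i)"
    and rows: "\<And>i. i < n \<Longrightarrow> (\<Sum>j<n. L $$ (i, j)) = 0"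
    and spec: "laplacian_spectrum n L (\<lambda>i. complex_of_real (lam i))"
    and lam: "0 < lmin" "\<And>i. 2 \<le> i \<Longrightarrow> i \<le> n \<Longrightarrow> lmin \<le> lam i"
    and v: "(\<Sum>i<n. v i) = 0"
  shows "lmin * (\<Sum>i<n. (v i)\<^sup>2) \<le> qform n L v v"
proof -
  obtain u \<mu> where u1: "(\<Sum>i<n. (u i)\<^sup>2) = 1" and u0: "(\<Sum>i<n. u i) = 0"
    and ev: "\<And>i. i < n \<Longrightarrow> (\<Sum>j<n. L $$ (i, j) * u j) = \<mu> * u i"
    and min: "\<And>v. (\<Sum>i<n. v i) = 0 \<Longrightarrow> \<mu> * (\<Sum>i<n. (v i)\<^sup>2) \<le> qform n L v v"
    by (rule rayleigh_minimiser[OF n sym rows]) blast+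
  let ?A = "map_mat complex_of_real L"
  define c where "c x = vec n (\<lambda>i. complex_of_real (x i))" for x :: "nat \<Rightarrow> real"
  have A: "?A \<in> carrier_mat n n" using L by simp
  have c: "c x \<in> carrier_vec n" for x by (simp add: c_def)
  have Ac: "?A *\<^sub>v c x = c (\<lambda>i. \<Sum>j<n. L $$ (i, j) * x j)" for x
    using L by (intro eq_vecI) (simp_all add: c_def scalar_prod_def lessThan_atLeast0)
  have unz: "c u \<noteq> 0\<^sub>v n"
  proof
    assume cu: "c u = 0\<^sub>v n"
    have "u i = 0" if "i < n" for i
      using that arg_cong[OF cu, of "\<lambda>x. vec_index x i"] by (simp add: c_def)
    then show False using u1 by simp
  qed
  have Au: "?A *\<^sub>v c u = complex_of_real \<mu> \<cdot>\<^sub>v c u"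
    unfolding Ac by (intro eq_vecI) (simp_all add: c_def ev flip: of_real_mult of_real_sum)
  then have "eigenvalue ?A (complex_of_real \<mu>)"
    unfolding eigenvalue_def eigenvector_def using unz c L by auto
  then have "poly (\<Prod>i\<in>{1..n}. [:- complex_of_real (lam i), 1:]) (complex_of_real \<mu>) = 0"
    using spec eigenvalue_root_char_poly[OF A] by (simp add: laplacian_spectrum_def)
  then obtain i where i: "1 \<le> i" "i \<le> n" "\<mu> = lam i"
    by (auto simp: poly_prod simp flip: of_real_diff of_real_minus of_real_add)
  have "i \<noteq> 1"
  proof
    assume "i = 1"
    then have \<mu>: "\<mu> = 0" using i spec by (simp add: laplacian_spectrum_def)
    have A1: "?A *\<^sub>v c (\<lambda>_. 1) = 0\<^sub>v n"
      unfolding Ac by (intro eq_vecI) (simp_all add: c_def rows flip: of_real_mult of_real_sum)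
    have "c (\<lambda>_. 1) \<noteq> 0\<^sub>v n"
    proof
      assume c0: "c (\<lambda>_. 1) = 0\<^sub>v n"
      show False using n arg_cong[OF c0, of "\<lambda>x. vec_index x 0"] by (simp add: c_def)
    qed
    moreover have "?A *\<^sub>v c u = 0\<^sub>v n" unfolding Au by (intro eq_vecI) (simp_all add: \<mu> c_def)
    moreover have "complex_of_real (lam i) \<noteq> 0" if "2 \<le> i" "i \<le> n" for i
      using lam(1) lam(2)[OF that] by simp
    moreover have "char_poly ?A = (\<Prod>i\<in>{1..n}. [:- complex_of_real (lam i), 1:])"
      using spec by (simp add: laplacian_spectrum_def)
    moreover have "0 < n" using n by simp
    ultimately obtain a where a: "c u = a \<cdot>\<^sub>v c (\<lambda>_. 1)"
      using simple_zero_eigenvalue_kernel[OF _ A _ _ c _ c A1] by metis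
    have ua: "complex_of_real (u i) = a" if "i < n" for i
      using that arg_cong[OF a, of "\<lambda>x. vec_index x i"] by (simp add: c_def)
    have "complex_of_real (\<Sum>i<n. u i) = (\<Sum>i<n. a)"
      unfolding of_real_sum by (intro sum.cong) (simp_all add: ua)
    then have "a = 0" using u0 n by simp
    then show False using ua u1 by simp
  qed
  with i lam(2)[of i] have "lmin \<le> \<mu>" by simp
  then have "lmin * (\<Sum>i<n. (v i)\<^sup>2) \<le> \<mu> * (\<Sum>i<n. (v i)\<^sup>2)"
    by (intro mult_right_mono sum_nonneg) auto
  with min[OF v] show ?thesis by linarith
qed

section \<open>Coercivity of the linear coupling\<close>

definition energy :: "nat \<Rightarrow> real mat \<Rightarrow> (nat \<Rightarrow> complex) \<Rightarrow> (nat \<Rightarrow> complex) \<Rightarrow> real" where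
  "energy n L p q = (\<Sum>i<n. \<Sum>j<n. L $$ (i, j) * inner (p i) (q j))"

lemma energy_eq_qform:
  "energy n L p q = qform n L (\<lambda>i. Re (p i)) (\<lambda>i. Re (q i)) + qform n L (\<lambda>i. Im (p i)) (\<lambda>i. Im (q i))"
  by (simp add: energy_def qform_def inner_complex_def sum.distrib algebra_simps)

lemma energy_gap:
  assumes gap: "\<And>v. (\<Sum>i<n. v i) = 0 \<Longrightarrow> lmin * (\<Sum>i<n. (v i)\<^sup>2) \<le> qform n L v v"
    and p: "(\<Sum>i<n. p i) = 0"
  shows "lmin * (\<Sum>i<n. (cmod (p i))\<^sup>2) \<le> energy n L p p"
proof -
  have "(\<Sum>i<n. Re (p i)) = 0" "(\<Sum>i<n. Im (p i)) = 0"
    using arg_cong[OF p, of Re] arg_cong[OF p, of Im] by simp_all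
  from gap[OF this(1)] gap[OF this(2)] show ?thesis
    by (simp add: energy_eq_qform cmod_power2 sum.distrib algebra_simps)
qed

text \<open>Cauchy--Schwarz for the positive semidefinite form \<open>energy\<close>, followed by the inequality of
  arithmetic and geometric means: expand the energy of \<open>p + u q\<close>, where \<open>u\<close> is the phase of \<open>c\<close>.\<close>

lemma energy_cross_lower_bound:
  assumes sym: "\<And>i j. i < n \<Longrightarrow> j < n \<Longrightarrow> L $$ (i, j) = L $$ (j, i)"
    and nonneg: "\<And>p. (\<Sum>i<n. p i) = 0 \<Longrightarrow> 0 \<le> energy n L p p"
    and p: "(\<Sum>i<n. p i) = 0" and q: "(\<Sum>i<n. q i) = 0"
  shows "- (cmod c / 2) * (energy n L p p + energy n L q q) \<le> energy n L p (\<lambda>i. c * q i)"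
proof (cases "c = 0")
  case True
  then show ?thesis by (simp add: energy_def)
next
  case False
  define u where "u = c / complex_of_real (cmod c)"
  have u: "cmod u = 1" using False by (simp add: u_def norm_divide)
  have cu: "c = complex_of_real (cmod c) * u" using False by (simp add: u_def)
  have Esym: "energy n L r s = energy n L s r" for r s
    unfolding energy_eq_qform using qform_sym[OF sym] by metis
  have add: "energy n L (\<lambda>i. r i + s i) (\<lambda>i. r i + s i)
      = energy n L r r + energy n L r s + energy n L s r + energy n L s s" for r s
    by (simp add: energy_def inner_add_left inner_add_right sum.distrib algebra_simps)
  have rot: "inner (u * x) (u * y) = inner x y" for x y :: complex
  proof -
    have "Re u * Re u + Im u * Im u = 1" using u cmod_power2[of u] by (simp add: power2_eq_square)
    moreover have "inner (u * x) (u * y) = (Re u * Re u + Im u * Im u) * inner x y"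
      by (simp add: inner_complex_def algebra_simps)
    ultimately show ?thesis by simp
  qed
  have "(\<Sum>i<n. p i + u * q i) = 0" using p q by (simp add: sum.distrib flip: sum_distrib_left)
  from nonneg[OF this]
  have "0 \<le> energy n L p p + 2 * energy n L p (\<lambda>i. u * q i) + energy n L q q"
    using Esym[of "\<lambda>i. u * q i" p] by (simp add: add) (simp add: energy_def rot)
  then have "0 \<le> cmod c / 2 * (energy n L p p + 2 * energy n L p (\<lambda>i. u * q i) + energy n L q q)"
    by simp
  moreover have "energy n L p (\<lambda>i. c * q i) = cmod c * energy n L p (\<lambda>i. u * q i)"
    by (subst cu) (simp add: energy_def inner_complex_def sum_distrib_left algebra_simps)
  ultimately show ?thesis by (simp add: algebra_simps)
qed

lemma energy_scale_diag:
  assumes sym: "\<And>i j. i < n \<Longrightarrow> j < n \<Longrightarrow> L $$ (i, j) = L $$ (j, i)"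
  shows "energy n L p (\<lambda>i. c * p i) = Re c * energy n L p p"
proof -
  have "energy n L p (\<lambda>i. c * p i) = Re c * energy n L p p
      + Im c * (qform n L (\<lambda>i. Im (p i)) (\<lambda>i. Re (p i)) - qform n L (\<lambda>i. Re (p i)) (\<lambda>i. Im (p i)))"
    by (simp add: energy_def qform_def inner_complex_def sum_distrib_left sum.distrib sum_subtractf
        algebra_simps)
  then show ?thesis using qform_sym[OF sym, of n "\<lambda>i. Im (p i)"] by simp
qed

text \<open>The two indices of \<open>a\<close>, node and coordinate, are treated separately. For a fixed pair of
  coordinates the sum over the nodes is an energy form: diagonal entries of \<open>T\<close> contribute at least
  \<open>b\<close> times an energy, and the off-diagonal ones are too small to consume more than half of it. The
  spectral gap is applied last, to each coordinate.\<close>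

lemma coupling_coercive:
  fixes a :: "nat \<Rightarrow> complex ^ 'm" and T :: "complex ^ 'm ^ 'm"
  assumes sym: "\<And>i j. i < n \<Longrightarrow> j < n \<Longrightarrow> L $$ (i, j) = L $$ (j, i)"
    and gap: "\<And>v. (\<Sum>i<n. v i) = 0 \<Longrightarrow> lmin * (\<Sum>i<n. (v i)\<^sup>2) \<le> qform n L v v"
    and lmin: "0 \<le> lmin"
    and diag: "\<And>k. b \<le> Re (T $ k $ k)"
    and off: "\<And>k l. k \<noteq> l \<Longrightarrow> cmod (T $ k $ l) \<le> \<eta>"
    and small: "real CARD('m) * \<eta> \<le> b / 2" and \<eta>: "0 \<le> \<eta>"
    and a: "(\<Sum>i<n. a i) = 0"
  shows "b / 2 * lmin * (\<Sum>i<n. (norm (a i))\<^sup>2)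
    \<le> (\<Sum>i<n. \<Sum>j<n. L $$ (i, j) * inner (a i) (T *v a j))"
proof -
  define E where "E k = energy n L (\<lambda>i. a i $ k) (\<lambda>i. a i $ k)" for k
  have ak: "(\<Sum>i<n. a i $ k) = 0" for k
    using arg_cong[OF a, of "\<lambda>x. x $ k"] by simp
  have gapE: "lmin * (\<Sum>i<n. (cmod (a i $ k))\<^sup>2) \<le> E k" for k
    unfolding E_def by (rule energy_gap[OF gap ak])
  have nonneg: "0 \<le> energy n L p p" if "(\<Sum>i<n. p i) = 0" for p
    using energy_gap[OF gap that] lmin
    by (meson mult_nonneg_nonneg order_trans sum_nonneg zero_le_power2)
  have E0: "0 \<le> E k" for k unfolding E_def by (rule nonneg[OF ak])
  have entry: "(if k = l then b * E k else 0) - \<eta> / 2 * (E k + E l)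
      \<le> energy n L (\<lambda>i. a i $ k) (\<lambda>i. T $ k $ l * a i $ l)" for k l
  proof (cases "k = l")
    case True
    have "b * E k \<le> Re (T $ k $ k) * E k" by (intro mult_right_mono diag E0)
    moreover have "0 \<le> \<eta> / 2 * (E k + E k)" using \<eta> E0[of k] by simp
    ultimately show ?thesis using True energy_scale_diag[OF sym, of n "\<lambda>i. a i $ k"] by (simp add: E_def)
  next
    case False
    have "cmod (T $ k $ l) / 2 * (E k + E l) \<le> \<eta> / 2 * (E k + E l)"
      using off[OF False] E0[of k] E0[of l] by (intro mult_right_mono) auto
    with energy_cross_lower_bound[OF sym nonneg ak[of k] ak[of l], where c = "T $ k $ l"] False
    show ?thesis by (simp add: E_def)
  qed
  have "(\<Sum>i<n. \<Sum>j<n. L $$ (i, j) * inner (a i) (T *v a j))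
      = (\<Sum>i<n. \<Sum>j<n. \<Sum>k\<in>UNIV. \<Sum>l\<in>UNIV. L $$ (i, j) * inner (a i $ k) (T $ k $ l * a j $ l))"
    by (simp add: inner_vec_def matrix_vector_mult_def inner_sum_right sum_distrib_left)
  also have "\<dots> = (\<Sum>i<n. \<Sum>k\<in>UNIV. \<Sum>l\<in>UNIV. \<Sum>j<n. L $$ (i, j) * inner (a i $ k) (T $ k $ l * a j $ l))"
    by (rule sum.cong[OF refl], subst sum.swap, rule sum.cong[OF refl], rule sum.swap)
  also have "\<dots> = (\<Sum>k\<in>UNIV. \<Sum>l\<in>UNIV. energy n L (\<lambda>i. a i $ k) (\<lambda>i. T $ k $ l * a i $ l))"
    unfolding energy_def by (subst sum.swap, rule sum.cong[OF refl], rule sum.swap)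
  finally have expand: "(\<Sum>i<n. \<Sum>j<n. L $$ (i, j) * inner (a i) (T *v a j))
      = (\<Sum>k\<in>UNIV. \<Sum>l\<in>UNIV. energy n L (\<lambda>i. a i $ k) (\<lambda>i. T $ k $ l * a i $ l))" .
  have "b / 2 * lmin * (\<Sum>i<n. (norm (a i))\<^sup>2) = b / 2 * (\<Sum>k\<in>UNIV. lmin * (\<Sum>i<n. (cmod (a i $ k))\<^sup>2))"
  proof -
    have "(norm (a i))\<^sup>2 = (\<Sum>k\<in>UNIV. (cmod (a i $ k))\<^sup>2)" for i
      by (simp add: power2_norm_eq_inner inner_vec_def)
    then have "(\<Sum>i<n. (norm (a i))\<^sup>2) = (\<Sum>k\<in>UNIV. \<Sum>i<n. (cmod (a i $ k))\<^sup>2)"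
      by (simp only:) (rule sum.swap)
    then show ?thesis by (simp only: sum_distrib_left[symmetric] mult.assoc)
  qed
  also have "\<dots> \<le> b / 2 * (\<Sum>k\<in>UNIV. E k)"
  proof -
    have "0 \<le> b / 2" using small \<eta> by (meson mult_nonneg_nonneg of_nat_0_le_iff order_trans)
    then show ?thesis by (intro mult_left_mono sum_mono gapE)
  qed
  also have "\<dots> \<le> (b - real CARD('m) * \<eta>) * (\<Sum>k\<in>UNIV. E k)"
    using small by (intro mult_right_mono sum_nonneg E0) auto
  also have "\<dots> = (\<Sum>k\<in>UNIV. \<Sum>l\<in>UNIV. (if k = l then b * E k else 0) - \<eta> / 2 * (E k + E l))"
  proof -
    have "(\<Sum>k\<in>UNIV. \<Sum>l\<in>UNIV. E k + E l) = 2 * real CARD('m) * (\<Sum>k\<in>UNIV. E k)"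
      by (simp add: sum.distrib sum_distrib_left[symmetric])
    then have "(\<Sum>k\<in>UNIV. \<Sum>l\<in>UNIV. \<eta> / 2 * (E k + E l)) = real CARD('m) * \<eta> * (\<Sum>k\<in>UNIV. E k)"
      by (simp only: sum_distrib_left[symmetric]) simp
    moreover have "(\<Sum>k\<in>UNIV. \<Sum>l\<in>UNIV. if k = l then b * E k else 0) = b * (\<Sum>k\<in>UNIV. E k)"
      by (simp add: sum_distrib_left)
    ultimately show ?thesis by (simp only: sum_subtractf left_diff_distrib)
  qed
  also have "\<dots> \<le> (\<Sum>k\<in>UNIV. \<Sum>l\<in>UNIV. energy n L (\<lambda>i. a i $ k) (\<lambda>i. T $ k $ l * a i $ l))"
    by (intro sum_mono entry)
  finally show ?thesis unfolding expand .
qed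

section \<open>Two facts on differential inequalities\<close>

text \<open>The differential inequality makes \<open>exp (a * (t - s)) * (u t - d / a)\<close> nonincreasing. The inequality
  is asked for in the open interval only, because an exit time need not satisfy it.\<close>

lemma linear_differential_inequality:
  fixes u :: "real \<Rightarrow> real"
  assumes "s \<le> b" and a: "0 < a" and cont: "continuous_on {s..b} u"
    and deriv: "\<And>t. s < t \<Longrightarrow> t < b \<Longrightarrow> \<exists>u'. (u has_real_derivative u') (at t) \<and> u' \<le> - a * u t + d"
  shows "u b \<le> d / a + exp (- a * (b - s)) * (u s - d / a)"
proof -
  define k where "k t = exp (a * (t - s)) * (u t - d / a)" for t
  have "k b \<le> k s"
  proof (rule DERIV_nonpos_imp_decreasing_open[OF \<open>s \<le> b\<close>])
    fix t assume "s < t" "t < b"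
    from deriv[OF this] obtain u' where u': "(u has_real_derivative u') (at t)" "u' \<le> - a * u t + d"
      by blast
    have "(k has_real_derivative exp (a * (t - s)) * (a * u t - d + u')) (at t)"
      unfolding k_def using a u'(1)
      by (auto intro!: derivative_eq_intros simp: algebra_simps)
    moreover have "exp (a * (t - s)) * (a * u t - d + u') \<le> 0"
      using u'(2) by (intro mult_nonneg_nonpos) auto
    ultimately show "\<exists>y. (k has_real_derivative y) (at t) \<and> y \<le> 0" by blast
  next
    show "continuous_on {s..b} k" unfolding k_def by (intro continuous_intros cont)
  qed
  then have "exp (- (a * (b - s))) * (exp (a * (b - s)) * (u b - d / a))
      \<le> exp (- (a * (b - s))) * (u s - d / a)"
    by (simp add: k_def)
  moreover have "exp (- (a * (b - s))) * (exp (a * (b - s)) * (u b - d / a)) = u b - d / a"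
    by (simp add: mult.assoc[symmetric] flip: exp_add)
  ultimately show ?thesis by simp
qed

text \<open>The disturbance \<open>e\<close> is controlled only while the curve is inside the ball; at the first exit time
  \<open>b\<close> nothing is known about the derivative. By continuity the field \<open>f\<close> still points inwards
  shortly before \<open>b\<close>, so the distance from the centre decreases there and cannot reach \<open>r\<close> at \<open>b\<close>.\<close>

lemma inflow_prevents_exit:
  fixes y :: "real \<Rightarrow> 'a :: euclidean_space"
  assumes s: "s < b" and r: "0 < r" and c: "0 < c"
    and f: "continuous_on UNIV (\<lambda>(t, x). f t x)"
    and inflow: "\<And>t x. x \<in> sphere p r \<Longrightarrow> inner (f t x) (x - p) \<le> - c"
    and cont: "continuous_on {s..b} y"
    and inside: "\<And>t. s \<le> t \<Longrightarrow> t < b \<Longrightarrow> y t \<in> ball p r"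
    and deriv: "\<And>t. s < t \<Longrightarrow> t < b \<Longrightarrow> (y has_vector_derivative f t (y t) + e t) (at t)"
    and small: "\<And>t. s < t \<Longrightarrow> t < b \<Longrightarrow> norm (e t) * r \<le> c / 2"
  shows "y b \<in> ball p r"
proof (rule ccontr)
  assume out: "y b \<notin> ball p r"
  have contb: "((\<lambda>t. y t) \<longlongrightarrow> y b) (at b within {s..b})"
    using cont s by (auto simp: continuous_on)
  have ev: "eventually (\<lambda>t. t \<in> {s..<b}) (at b within {s..b})"
    using s by (auto simp: eventually_at_filter)
  have nontriv: "at b within {s..b} \<noteq> bot" using s by (simp add: trivial_limit_within islimpt_Icc)
  have "y b \<in> cball p r"
    by (rule Lim_in_closed_set[OF closed_cball _ nontriv contb])
      (use ev inside in \<open>force elim!: eventually_mono\<close>)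
  with out have yb: "y b \<in> sphere p r" by auto
  define G where "G t = inner (f t (y t)) (y t - p)" for t
  have contf: "continuous_on {s..b} (\<lambda>t. f t (y t))"
    using continuous_on_compose2[OF f, of "{s..b}" "\<lambda>t. (t, y t)"] cont
    by (simp add: continuous_on_Pair continuous_on_id)
  have "continuous_on {s..b} G" unfolding G_def by (intro continuous_intros contf cont)
  then have "(G \<longlongrightarrow> G b) (at b within {s..b})" using s by (auto simp: continuous_on)
  moreover have "G b < - c / 2" using inflow[OF yb, of b] c by (simp add: G_def)
  ultimately have "eventually (\<lambda>t. G t < - c / 2) (at b within {s..b})"
    by (rule order_tendstoD(2))
  then obtain d where d: "0 < d" "\<And>t. t \<in> {s..b} \<Longrightarrow> t \<noteq> b \<Longrightarrow> dist t b < d \<Longrightarrow> G t < - c / 2"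
    by (auto simp: eventually_at)
  define s' where "s' = max s (b - d / 2)"
  have s': "s \<le> s'" "s' < b" "b - s' < d" using s d(1) by (auto simp: s'_def)
  define q where "q t = inner (y t - p) (y t - p)" for t
  have "q b \<le> q s'"
  proof (rule DERIV_nonpos_imp_decreasing_open[where f = q])
    show "s' \<le> b" using s' by simp
    show "continuous_on {s'..b} q"
      unfolding q_def using s' by (intro continuous_intros continuous_on_subset[OF cont]) auto
    fix t assume t: "s' < t" "t < b"
    then have t': "s < t" using s' by simp
    have "(q has_real_derivative 2 * inner (f t (y t) + e t) (y t - p)) (at t)"
      unfolding q_def using deriv[OF t' t(2)]
      by (auto intro!: derivative_eq_intros simp: has_vector_derivative_def has_field_derivative_def
          inner_commute algebra_simps fun_eq_iff)
    moreover have "inner (f t (y t) + e t) (y t - p) \<le> 0"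
    proof -
      have "inner (e t) (y t - p) \<le> norm (e t) * norm (y t - p)" by (rule norm_cauchy_schwarz)
      also have "\<dots> \<le> norm (e t) * r"
        using inside[of t] t t' by (intro mult_left_mono) (auto simp: dist_norm norm_minus_commute)
      also have "\<dots> \<le> c / 2" by (rule small[OF t' t(2)])
      finally have "inner (e t) (y t - p) \<le> c / 2" .
      moreover have "G t < - c / 2" using d(2)[of t] t t' s' by (simp add: dist_real_def)
      ultimately show ?thesis by (simp add: G_def inner_add_left)
    qed
    ultimately show "\<exists>D. (q has_real_derivative D) (at t) \<and> D \<le> 0"
      by (intro exI[of _ "2 * inner (f t (y t) + e t) (y t - p)"] conjI) auto
  qed
  then have "norm (y b - p) \<le> norm (y s' - p)" by (simp add: q_def norm_le)
  then show False using inside[of s'] s' out by (simp add: dist_norm norm_minus_commute)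
qed

section \<open>The disagreement of the nodes\<close>

definition mean :: "nat \<Rightarrow> (nat \<Rightarrow> 'a :: real_vector) \<Rightarrow> 'a" where
  "mean n x = (1 / real n) *\<^sub>R (\<Sum>i<n. x i)"

text \<open>The Lyapunov function. The linear map \<open>w\<close> is the change of coordinates adapted to the coupling.\<close>

definition disagreement :: "nat \<Rightarrow> ('a :: real_vector \<Rightarrow> 'b :: real_normed_vector) \<Rightarrow> (nat \<Rightarrow> 'a) \<Rightarrow> real" where
  "disagreement n w x = (\<Sum>i<n. (norm (w (x i - mean n x)))\<^sup>2)"

lemma sum_diff_mean: "0 < n \<Longrightarrow> (\<Sum>i<n. x i - mean n x) = 0"
  by (simp add: mean_def sum_subtractf sum_constant_scaleR)

lemma disagreement_nonneg: "0 \<le> disagreement n w x"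
  by (simp add: disagreement_def sum_nonneg)

lemma norm_le_sqrt_disagreement:
  assumes "i < n" shows "norm (w (x i - mean n x)) \<le> sqrt (disagreement n w x)"
proof -
  have "(norm (w (x i - mean n x)))\<^sup>2 \<le> disagreement n w x"
    unfolding disagreement_def using assms
    by (intro member_le_sum[of i _ "\<lambda>i. (norm (w (x i - mean n x)))\<^sup>2"]) auto
  then show ?thesis by (rule real_le_rsqrt)
qed

lemma mean_in_ball:
  fixes x :: "nat \<Rightarrow> 'a :: real_normed_vector"
  assumes n: "0 < n" and x: "\<And>i. i < n \<Longrightarrow> x i \<in> ball p r"
  shows "mean n x \<in> ball p r"
proof -
  have "(\<Sum>i<n. (1 / real n) *\<^sub>R x i) \<in> ball p r"
    by (rule convex_sum) (use n x in auto)
  then show ?thesis by (simp add: mean_def scaleR_right.sum)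
qed

lemma pairwise_le_disagreement:
  assumes k1: "0 < k1" and low: "\<And>v. k1 * norm v \<le> norm (w v)" and ij: "i < n" "j < n"
  shows "norm (x i - x j) \<le> 2 / k1 * sqrt (disagreement n w x)"
proof -
  have "k1 * norm (x l - mean n x) \<le> sqrt (disagreement n w x)" if "l < n" for l
    using low norm_le_sqrt_disagreement[OF that] by (rule order_trans)
  from this[OF ij(1)] this[OF ij(2)]
  have "norm (x i - mean n x) + norm (x j - mean n x) \<le> 2 / k1 * sqrt (disagreement n w x)"
    using k1 by (simp add: field_simps)
  moreover have "norm (x i - x j) \<le> norm (x i - mean n x) + norm (x j - mean n x)"
    using norm_triangle_ineq4[of "x i - mean n x" "x j - mean n x"] by simp
  ultimately show ?thesis by linarith
qed

lemma disagreement_le_pairwise: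
  assumes n: "0 < n" and up: "\<And>v. norm (w v) \<le> k2 * norm v" and k2: "0 \<le> k2"
    and \<delta>: "\<And>i j. i < n \<Longrightarrow> j < n \<Longrightarrow> norm (x i - x j) \<le> \<delta>"
  shows "disagreement n w x \<le> real n * (k2 * \<delta>)\<^sup>2"
proof -
  have "(norm (w (x i - mean n x)))\<^sup>2 \<le> (k2 * \<delta>)\<^sup>2" if i: "i < n" for i
  proof -
    have "x i - mean n x = (1 / real n) *\<^sub>R (\<Sum>j<n. x i - x j)"
      using n by (simp add: mean_def sum_subtractf sum_constant_scaleR algebra_simps)
    also have "norm \<dots> \<le> (1 / real n) * (\<Sum>j<n. \<delta>)"
      using \<delta>[OF i] by (auto intro!: mult_left_mono sum_norm_le divide_right_mono simp del: sum_constant)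
    also have "\<dots> = \<delta>" using n by simp
    finally have "norm (w (x i - mean n x)) \<le> k2 * \<delta>"
      using up[of "x i - mean n x"] k2 by (meson mult_left_mono order_trans)
    then show ?thesis by (intro power_mono) auto
  qed
  then have "disagreement n w x \<le> (\<Sum>i<n. (k2 * \<delta>)\<^sup>2)"
    unfolding disagreement_def by (intro sum_mono) auto
  then show ?thesis by simp
qed

text \<open>The average over ordered pairs of distinct nodes is at most \<open>2 / (n - 1)\<close> times the sum of the
  distances from the mean, and Cauchy--Schwarz bounds this sum by the square root of \<open>n\<close> times the
  disagreement. As \<open>n \<le> 2 * (n - 1)\<close>, the result is a multiple, with a factor independent of \<open>n\<close>, of
  the root mean square deviation.\<close>

lemma average_sync_error_le:
  fixes x :: "nat \<Rightarrow> real \<Rightarrow> real ^ 'm" and w :: "real ^ 'm \<Rightarrow> 'b :: real_normed_vector"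
  assumes n: "2 \<le> n" and k1: "0 < k1" and low: "\<And>v. k1 * norm v \<le> norm (w v)"
  shows "average_sync_error n x t \<le> 4 / k1 * sqrt (disagreement n w (\<lambda>i. x i t) / real n)"
proof -
  define z where "z i = norm (w (x i t - mean n (\<lambda>i. x i t)))" for i
  have pair: "norm (x i t - x j t) \<le> (z i + z j) / k1" for i j
  proof -
    have "norm (x i t - x j t) \<le> norm (x i t - mean n (\<lambda>i. x i t)) + norm (x j t - mean n (\<lambda>i. x i t))"
      using norm_triangle_ineq4[of "x i t - mean n (\<lambda>i. x i t)" "x j t - mean n (\<lambda>i. x i t)"] by simp
    then have "k1 * norm (x i t - x j t)
        \<le> k1 * norm (x i t - mean n (\<lambda>i. x i t)) + k1 * norm (x j t - mean n (\<lambda>i. x i t))"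
      using k1 by (simp flip: distrib_left)
    also have "\<dots> \<le> z i + z j" unfolding z_def by (intro add_mono low)
    finally show ?thesis using k1 by (simp add: field_simps)
  qed
  have "(\<Sum>i<n. \<Sum>j<n. norm (x i t - x j t)) \<le> (\<Sum>i<n. \<Sum>j<n. (z i + z j) / k1)"
    by (intro sum_mono pair)
  also have "\<dots> = 2 * real n / k1 * (\<Sum>i<n. z i)"
    by (simp add: add_divide_distrib sum.distrib sum_divide_distrib[symmetric] sum_distrib_left[symmetric])
  finally have sum_le: "(\<Sum>i<n. \<Sum>j<n. norm (x i t - x j t)) \<le> 2 * real n / k1 * (\<Sum>i<n. z i)" .
  have "(\<Sum>i<n. z i) \<le> sqrt (real n * disagreement n w (\<lambda>i. x i t))"
  proof (rule real_le_rsqrt)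
    have "(\<Sum>i<n. z i)\<^sup>2 \<le> (\<Sum>i<n. (z i)\<^sup>2) * real (card {..<n})"
      by (rule sum_squared_le_sum_of_squares)
    then show "(\<Sum>i<n. z i)\<^sup>2 \<le> real n * disagreement n w (\<lambda>i. x i t)"
      by (simp add: disagreement_def z_def mult.commute)
  qed
  then have "2 * real n / k1 * (\<Sum>i<n. z i)
      \<le> 2 * real n / k1 * sqrt (real n * disagreement n w (\<lambda>i. x i t))"
    using k1 by (intro mult_left_mono) auto
  with sum_le have le: "(\<Sum>i<n. \<Sum>j<n. norm (x i t - x j t))
      \<le> 2 * real n / k1 * sqrt (real n * disagreement n w (\<lambda>i. x i t))"
    by (rule order_trans)
  have pos: "0 < real n * (real n - 1)" using n by simp
  have "average_sync_error n x t
      \<le> 1 / (real n * (real n - 1)) * (2 * real n / k1 * sqrt (real n * disagreement n w (\<lambda>i. x i t)))"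
    unfolding average_sync_error_def using pos by (intro mult_left_mono le) auto
  also have "sqrt (real n * disagreement n w (\<lambda>i. x i t)) = real n * sqrt (disagreement n w (\<lambda>i. x i t) / real n)"
    using n by (simp add: real_sqrt_mult real_sqrt_divide field_simps)
  also have "1 / (real n * (real n - 1)) * (2 * real n / k1 * (real n * sqrt (disagreement n w (\<lambda>i. x i t) / real n)))
      = (real n / (real n - 1)) * (2 / k1 * sqrt (disagreement n w (\<lambda>i. x i t) / real n))"
    using n k1 by (simp add: field_simps)
  also have "\<dots> \<le> 2 * (2 / k1 * sqrt (disagreement n w (\<lambda>i. x i t) / real n))"
    using n k1 disagreement_nonneg[of n w] by (intro mult_right_mono) (simp_all add: field_simps)
  finally show ?thesis by simp
qed

text \<open>The velocity of the mean drops out because the deviations from the mean add up to zero.\<close>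

lemma disagreement_has_derivative:
  fixes x :: "nat \<Rightarrow> real \<Rightarrow> 'a :: euclidean_space" and w :: "'a \<Rightarrow> 'b :: real_inner"
  assumes n: "0 < n" and w: "linear w"
    and x: "\<And>i. i < n \<Longrightarrow> (x i has_vector_derivative dx i) (at t)"
  shows "((\<lambda>t. disagreement n w (\<lambda>i. x i t)) has_real_derivative
    2 * (\<Sum>i<n. inner (w (x i t - mean n (\<lambda>i. x i t))) (w (dx i)))) (at t)"
proof -
  define z where "z i t = w (x i t - mean n (\<lambda>i. x i t))" for i t
  have bl: "bounded_linear w" using w by (rule linear_conv_bounded_linear[THEN iffD1])
  have mean: "((\<lambda>t. mean n (\<lambda>i. x i t)) has_vector_derivative mean n dx) (at t)"
    unfolding mean_def using x
    by (auto intro!: derivative_eq_intros)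
  have z: "(z i has_vector_derivative w (dx i - mean n dx)) (at t)" if "i < n" for i
    unfolding z_def
    by (intro bounded_linear.has_vector_derivative[OF bl] has_vector_derivative_diff x that mean)
  have sq: "((\<lambda>t. (norm (z i t))\<^sup>2) has_real_derivative 2 * inner (z i t) (w (dx i - mean n dx))) (at t)"
    if "i < n" for i
    unfolding power2_norm_eq_inner using z[OF that]
    by (auto intro!: derivative_eq_intros simp: has_vector_derivative_def has_field_derivative_def
        inner_commute algebra_simps fun_eq_iff)
  have "((\<lambda>t. disagreement n w (\<lambda>i. x i t)) has_real_derivative
      (\<Sum>i<n. 2 * inner (z i t) (w (dx i - mean n dx)))) (at t)"
    unfolding disagreement_def z_def[symmetric] by (intro DERIV_sum sq) auto
  moreover have "(\<Sum>i<n. inner (z i t) (w (mean n dx))) = 0"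
  proof -
    have "(\<Sum>i<n. z i t) = w (\<Sum>i<n. x i t - mean n (\<lambda>i. x i t))"
      by (simp add: z_def linear_sum[OF w])
    also have "\<dots> = 0" using sum_diff_mean[OF n] linear_0[OF w] by metis
    finally show ?thesis by (simp flip: inner_sum_left)
  qed
  ultimately show ?thesis
    by (simp add: z_def linear_diff[OF w] inner_diff_right sum_subtractf flip: sum_distrib_left)
qed

section \<open>Dissipation and confinement\<close>

text \<open>Four contributions to the velocity of a node are estimated. Since the deviations have zero sum,
  \<open>F\<close> may be replaced by its difference from the value at the mean, which costs its Lipschitz
  constant. The perturbation is absorbed up to a quarter of the rate by Young's inequality. The
  nonlinear part of the coupling takes another quarter, as \<open>\<eta>\<close> may be chosen depending on the
  network. The linear part of the coupling provides the dissipation. The perturbation enters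
  through a sum over the nodes, hence with the factor \<open>n\<close> that the average error divides out.\<close>

lemma disagreement_dissipation:
  fixes y g :: "nat \<Rightarrow> 'a :: euclidean_space" and w :: "'a \<Rightarrow> 'b :: real_inner"
  assumes n: "0 < n" and w: "linear w" and G: "linear G"
    and k1: "0 < k1" and low: "\<And>v. k1 * norm v \<le> norm (w v)"
    and k2: "0 \<le> k2" and up: "\<And>v. norm (w v) \<le> k2 * norm v"
    and \<alpha>: "0 \<le> \<alpha>" and \<eta>: "0 \<le> \<eta>" and lip0: "0 \<le> lip"
    and lap: "\<And>i j. i < n \<Longrightarrow> j < n \<Longrightarrow>
      L $$ (i, j) = (if i = j then \<Sum>j<n. W $$ (i, j) else 0) - W $$ (i, j)"
    and coercive: "\<kappa> * disagreement n w y
      \<le> (\<Sum>i<n. \<Sum>j<n. L $$ (i, j) * inner (w (y i - mean n y)) (w (G (y j - mean n y))))"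
    and lip: "\<And>i. i < n \<Longrightarrow> norm (F (y i) - F (mean n y)) \<le> lip * norm (y i - mean n y)"
    and noise: "\<And>i. i < n \<Longrightarrow> norm (g i) \<le> \<epsilon>"
    and rem: "\<And>i j. i < n \<Longrightarrow> j < n \<Longrightarrow>
      norm (h (y j - y i) - G (y j - y i)) \<le> \<eta> * norm (y j - y i)"
    and a: "a = \<alpha> * \<kappa> - k2 / k1 * lip" "0 < a"
    and \<eta>_small: "\<alpha> * k2 * \<eta> / k1 * 2 * (\<Sum>i<n. \<Sum>j<n. \<bar>W $$ (i, j)\<bar>) \<le> a / 4"
  shows "2 * (\<Sum>i<n. inner (w (y i - mean n y))
      (w (F (y i) + g i + \<alpha> *\<^sub>R (\<Sum>j<n. W $$ (i, j) *\<^sub>R h (y j - y i)))))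
    \<le> - a * disagreement n w y + 2 * real n * k2\<^sup>2 * \<epsilon>\<^sup>2 / a"
proof -
  define z where "z i = y i - mean n y" for i
  define V where "V = disagreement n w y"
  have V_eq: "V = (\<Sum>i<n. (norm (w (z i)))\<^sup>2)" by (simp add: V_def z_def disagreement_def)
  have zi_le: "(norm (w (z i)))\<^sup>2 \<le> V" if "i < n" for i
    unfolding V_eq using that by (intro member_le_sum[of i _ "\<lambda>i. (norm (w (z i)))\<^sup>2"]) auto
  define R where "R i j = h (y j - y i) - G (y j - y i)" for i j
  have z_sum: "(\<Sum>i<n. w (z i)) = 0"
    using sum_diff_mean[OF n, of y] linear_sum[OF w, of z "{..<n}"] linear_0[OF w]
    by (simp add: z_def)
  have zdiff: "y j - y i = z j - z i" for i j by (simp add: z_def)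
  have lapG: "(\<Sum>j<n. W $$ (i, j) *\<^sub>R G (y j - y i)) = - (\<Sum>j<n. L $$ (i, j) *\<^sub>R G (z j))"
    if i: "i < n" for i
  proof -
    have "(\<Sum>j<n. L $$ (i, j) *\<^sub>R G (z j))
        = (\<Sum>j<n. (if i = j then (\<Sum>j<n. W $$ (i, j)) *\<^sub>R G (z j) else 0) - W $$ (i, j) *\<^sub>R G (z j))"
      using i by (intro sum.cong refl) (simp add: lap scaleR_diff_left)
    also have "\<dots> = (\<Sum>j<n. W $$ (i, j)) *\<^sub>R G (z i) - (\<Sum>j<n. W $$ (i, j) *\<^sub>R G (z j))"
      using i by (simp add: sum_subtractf)
    also have "\<dots> = - (\<Sum>j<n. W $$ (i, j) *\<^sub>R G (y j - y i))"
      by (simp add: zdiff linear_diff[OF G] scaleR_diff_right sum_subtractf scaleR_left.sum)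
    finally show ?thesis by simp
  qed
  have split: "F (y i) + g i + \<alpha> *\<^sub>R (\<Sum>j<n. W $$ (i, j) *\<^sub>R h (y j - y i))
      = F (mean n y) + (F (y i) - F (mean n y)) + g i
        + (\<Sum>j<n. (\<alpha> * W $$ (i, j)) *\<^sub>R R i j) - \<alpha> *\<^sub>R (\<Sum>j<n. L $$ (i, j) *\<^sub>R G (z j))"
    if i: "i < n" for i
  proof -
    have eq: "(\<Sum>j<n. W $$ (i, j) *\<^sub>R h (y j - y i))
        = (\<Sum>j<n. W $$ (i, j) *\<^sub>R R i j) + (\<Sum>j<n. W $$ (i, j) *\<^sub>R G (y j - y i))"
      by (simp add: R_def sum.distrib[symmetric] scaleR_add_right[symmetric])
    have "(\<Sum>j<n. (\<alpha> * W $$ (i, j)) *\<^sub>R R i j) = \<alpha> *\<^sub>R (\<Sum>j<n. W $$ (i, j) *\<^sub>R R i j)"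
      by (simp add: scaleR_right.sum)
    then show ?thesis
      unfolding eq lapG[OF i] by (simp add: scaleR_diff_right)
  qed
  have drift: "inner (w (z i)) (w (F (y i) - F (mean n y))) \<le> k2 / k1 * lip * (norm (w (z i)))\<^sup>2"
    if i: "i < n" for i
  proof -
    have "norm (w (F (y i) - F (mean n y))) \<le> k2 * (lip * norm (z i))"
      using up lip[OF i] k2 unfolding z_def by (meson mult_left_mono order_trans)
    also have "\<dots> \<le> k2 * (lip * (norm (w (z i)) / k1))"
      using low[of "z i"] k1 k2 lip0 by (intro mult_left_mono) (simp_all add: field_simps)
    finally have "norm (w (z i)) * norm (w (F (y i) - F (mean n y)))
        \<le> norm (w (z i)) * (k2 * (lip * (norm (w (z i)) / k1)))"
      by (rule mult_left_mono) simp
    then show ?thesis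
      using norm_cauchy_schwarz[of "w (z i)" "w (F (y i) - F (mean n y))"]
      by (simp add: power2_eq_square field_simps)
  qed
  have pert: "inner (w (z i)) (w (g i)) \<le> a / 4 * (norm (w (z i)))\<^sup>2 + k2\<^sup>2 * \<epsilon>\<^sup>2 / a"
    if i: "i < n" for i
  proof -
    have "norm (w (g i)) \<le> k2 * \<epsilon>"
      using up noise[OF i] k2 by (meson mult_left_mono order_trans)
    then have "inner (w (z i)) (w (g i)) \<le> norm (w (z i)) * (k2 * \<epsilon>)"
      using norm_cauchy_schwarz[of "w (z i)" "w (g i)"] by (meson mult_left_mono norm_ge_zero order_trans)
    also have "\<dots> \<le> a / 4 * (norm (w (z i)))\<^sup>2 + k2\<^sup>2 * \<epsilon>\<^sup>2 / a"
    proof -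
      have "0 \<le> (a / 2 * norm (w (z i)) - k2 * \<epsilon>)\<^sup>2 / a" using a(2) by simp
      then show ?thesis using a(2) by (simp add: power2_eq_square field_simps)
    qed
    finally show ?thesis .
  qed
  have remainder: "inner (w (z i)) (w ((\<alpha> * W $$ (i, j)) *\<^sub>R R i j))
      \<le> \<alpha> * k2 * \<eta> / k1 * 2 * V * \<bar>W $$ (i, j)\<bar>" if i: "i < n" and j: "j < n" for i j
  proof -
    have zz: "norm (w (z i)) * (norm (w (z j)) + norm (w (z i))) \<le> 2 * V"
    proof -
      have "2 * (norm (w (z i)) * norm (w (z j))) \<le> (norm (w (z i)))\<^sup>2 + (norm (w (z j)))\<^sup>2"
        using sum_squares_bound[of "norm (w (z i))" "norm (w (z j))"] by simp
      then show ?thesis using zi_le[OF i] zi_le[OF j] by (simp add: power2_eq_square algebra_simps)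
    qed
    have yz: "norm (y j - y i) \<le> (norm (w (z j)) + norm (w (z i))) / k1"
    proof -
      have "k1 * norm (y j - y i) \<le> norm (w (z j - z i))" using low by (simp add: zdiff)
      also have "\<dots> \<le> norm (w (z j)) + norm (w (z i))"
        by (simp add: linear_diff[OF w] norm_triangle_ineq4)
      finally show ?thesis using k1 by (simp add: field_simps)
    qed
    have "norm (w (R i j)) \<le> k2 * (\<eta> * norm (y j - y i))"
      using up rem[OF i j] k2 unfolding R_def by (meson mult_left_mono order_trans)
    also have "\<dots> \<le> k2 * (\<eta> * ((norm (w (z j)) + norm (w (z i))) / k1))"
      using k2 \<eta> by (intro mult_left_mono yz)
    finally have "norm (w (z i)) * norm (w (R i j))
        \<le> norm (w (z i)) * (k2 * (\<eta> * ((norm (w (z j)) + norm (w (z i))) / k1)))"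
      by (rule mult_left_mono) simp
    also have "\<dots> = k2 * \<eta> / k1 * (norm (w (z i)) * (norm (w (z j)) + norm (w (z i))))"
      by (simp add: field_simps)
    also have "\<dots> \<le> k2 * \<eta> / k1 * (2 * V)"
      using k1 k2 \<eta> by (intro mult_left_mono zz) auto
    finally have b: "norm (w (z i)) * norm (w (R i j)) \<le> k2 * \<eta> / k1 * (2 * V)" .
    have "inner (w (z i)) (w ((\<alpha> * W $$ (i, j)) *\<^sub>R R i j))
        \<le> norm (w (z i)) * norm (w ((\<alpha> * W $$ (i, j)) *\<^sub>R R i j))"
      by (rule norm_cauchy_schwarz)
    also have "\<dots> = \<alpha> * \<bar>W $$ (i, j)\<bar> * (norm (w (z i)) * norm (w (R i j)))"
      using \<alpha> by (simp add: linear_scale[OF w] abs_mult)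
    also have "\<dots> \<le> \<alpha> * \<bar>W $$ (i, j)\<bar> * (k2 * \<eta> / k1 * (2 * V))"
      using \<alpha> by (intro mult_left_mono b) auto
    finally show ?thesis by (simp add: mult_ac)
  qed
  have node: "inner (w (z i)) (w (F (y i) + g i + \<alpha> *\<^sub>R (\<Sum>j<n. W $$ (i, j) *\<^sub>R h (y j - y i))))
      \<le> inner (w (z i)) (w (F (mean n y))) + (k2 / k1 * lip + a / 4) * (norm (w (z i)))\<^sup>2
        + k2\<^sup>2 * \<epsilon>\<^sup>2 / a + \<alpha> * k2 * \<eta> / k1 * 2 * V * (\<Sum>j<n. \<bar>W $$ (i, j)\<bar>)
        - \<alpha> * (\<Sum>j<n. L $$ (i, j) * inner (w (z i)) (w (G (z j))))"
    if i: "i < n" for i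
  proof -
    have "inner (w (z i)) (w (F (y i) + g i + \<alpha> *\<^sub>R (\<Sum>j<n. W $$ (i, j) *\<^sub>R h (y j - y i))))
      = inner (w (z i)) (w (F (mean n y))) + inner (w (z i)) (w (F (y i) - F (mean n y)))
        + inner (w (z i)) (w (g i)) + (\<Sum>j<n. inner (w (z i)) (w ((\<alpha> * W $$ (i, j)) *\<^sub>R R i j)))
        - \<alpha> * (\<Sum>j<n. L $$ (i, j) * inner (w (z i)) (w (G (z j))))"
      unfolding split[OF i] linear_add[OF w] linear_diff[OF w] linear_scale[OF w] linear_sum[OF w]
        inner_add_right inner_diff_right inner_scaleR_right inner_sum_right ..
    moreover have "(\<Sum>j<n. inner (w (z i)) (w ((\<alpha> * W $$ (i, j)) *\<^sub>R R i j)))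
        \<le> (\<Sum>j<n. \<alpha> * k2 * \<eta> / k1 * 2 * V * \<bar>W $$ (i, j)\<bar>)"
      using i by (intro sum_mono remainder) auto
    ultimately show ?thesis
      using drift[OF i] pert[OF i] unfolding distrib_right sum_distrib_left by linarith
  qed
  have "(\<Sum>i<n. inner (w (z i)) (w (F (y i) + g i + \<alpha> *\<^sub>R (\<Sum>j<n. W $$ (i, j) *\<^sub>R h (y j - y i)))))
    \<le> (\<Sum>i<n. inner (w (z i)) (w (F (mean n y))) + (k2 / k1 * lip + a / 4) * (norm (w (z i)))\<^sup>2
        + k2\<^sup>2 * \<epsilon>\<^sup>2 / a + \<alpha> * k2 * \<eta> / k1 * 2 * V * (\<Sum>j<n. \<bar>W $$ (i, j)\<bar>)
        - \<alpha> * (\<Sum>j<n. L $$ (i, j) * inner (w (z i)) (w (G (z j)))))"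
    by (intro sum_mono node) auto
  also have "\<dots> = inner (\<Sum>i<n. w (z i)) (w (F (mean n y))) + (k2 / k1 * lip + a / 4) * V
        + real n * (k2\<^sup>2 * \<epsilon>\<^sup>2 / a)
        + \<alpha> * k2 * \<eta> / k1 * 2 * V * (\<Sum>i<n. \<Sum>j<n. \<bar>W $$ (i, j)\<bar>)
        - \<alpha> * (\<Sum>i<n. \<Sum>j<n. L $$ (i, j) * inner (w (z i)) (w (G (z j))))"
    unfolding sum.distrib sum_subtractf V_eq inner_sum_left sum_distrib_left by simp
  also have "\<dots> \<le> 0 + (k2 / k1 * lip + a / 4) * V + real n * (k2\<^sup>2 * \<epsilon>\<^sup>2 / a) + a / 4 * V - \<alpha> * (\<kappa> * V)"
  proof -
    have V0: "0 \<le> V" unfolding V_def by (rule disagreement_nonneg)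
    have "\<alpha> * (\<kappa> * V) \<le> \<alpha> * (\<Sum>i<n. \<Sum>j<n. L $$ (i, j) * inner (w (z i)) (w (G (z j))))"
      using coercive \<alpha> unfolding V_def z_def by (rule mult_left_mono)
    moreover have "\<alpha> * k2 * \<eta> / k1 * 2 * V * (\<Sum>i<n. \<Sum>j<n. \<bar>W $$ (i, j)\<bar>) \<le> a / 4 * V"
      using mult_right_mono[OF \<eta>_small V0] by (simp add: mult_ac)
    ultimately show ?thesis by (simp add: z_sum)
  qed
  also have "\<dots> = - (a / 2) * V + real n * (k2\<^sup>2 * \<epsilon>\<^sup>2 / a)"
  proof -
    have "\<alpha> * (\<kappa> * V) = (a + k2 / k1 * lip) * V" by (simp add: a(1))
    then show ?thesis by (simp add: algebra_simps)
  qed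
  finally have half: "(\<Sum>i<n. inner (w (z i))
      (w (F (y i) + g i + \<alpha> *\<^sub>R (\<Sum>j<n. W $$ (i, j) *\<^sub>R h (y j - y i)))))
    \<le> - (a / 2) * V + real n * (k2\<^sup>2 * \<epsilon>\<^sup>2 / a)" .
  have "2 * real n * k2\<^sup>2 * \<epsilon>\<^sup>2 / a = 2 * (real n * (k2\<^sup>2 * \<epsilon>\<^sup>2 / a))" by simp
  with half show ?thesis unfolding V_def[symmetric] z_def[symmetric] by linarith
qed

text \<open>The dissipation estimate holds only while all nodes are in the ball and their disagreement is
  small, and both are consequences of that estimate. At the first time at which one of them fails,
  the differential inequality has kept the disagreement strictly below \<open>v\<close>, so some node has left
  the ball, which either the inflow or the alternative in \<open>confined\<close> excludes.\<close>

lemma network_solution_trapped: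
  fixes w :: "real ^ 'm \<Rightarrow> 'b :: real_inner"
  assumes n: "0 < n" and w: "linear w" and r: "0 < r"
    and f: "continuous_on UNIV (\<lambda>(t, x). f t x)"
    and sol: "network_solution f g n W h \<alpha> t0 x"
    and start: "\<And>i. i < n \<Longrightarrow> x i t0 \<in> ball p r"
      "disagreement n w (\<lambda>i. x i t0) < v"
    and a: "0 < a" and d: "d / a < v"
    and decay: "\<And>t. t0 < t \<Longrightarrow> (\<And>i. i < n \<Longrightarrow> x i t \<in> ball p r) \<Longrightarrow>
      disagreement n w (\<lambda>i. x i t) < v \<Longrightarrow>
      2 * (\<Sum>i<n. inner (w (x i t - mean n (\<lambda>i. x i t)))
        (w (f t (x i t) + g i t (x i t) + \<alpha> *\<^sub>R (\<Sum>j<n. W $$ (i, j) *\<^sub>R h (x j t - x i t)))))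
      \<le> - a * disagreement n w (\<lambda>i. x i t) + d"
    and confined: "(\<forall>i<n. \<forall>t\<ge>t0. x i t \<in> ball p r) \<or>
      (\<exists>c>0. (\<forall>t. \<forall>x\<in>sphere p r. inner (f t x) (x - p) \<le> - c) \<and>
        (\<forall>t>t0. \<forall>i<n. (\<forall>i<n. x i t \<in> ball p r) \<longrightarrow> disagreement n w (\<lambda>i. x i t) < v \<longrightarrow>
          norm (g i t (x i t) + \<alpha> *\<^sub>R (\<Sum>j<n. W $$ (i, j) *\<^sub>R h (x j t - x i t))) * r \<le> c / 2))"
    and t: "t0 \<le> t"
  shows "disagreement n w (\<lambda>i. x i t)
    \<le> d / a + exp (- a * (t - t0)) * (disagreement n w (\<lambda>i. x i t0) - d / a)"
proof -
  define D where "D t = disagreement n w (\<lambda>i. x i t)" for t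
  define dx where "dx i t = f t (x i t) + g i t (x i t)
    + \<alpha> *\<^sub>R (\<Sum>j<n. W $$ (i, j) *\<^sub>R h (x j t - x i t))" for i t
  have within: "(x i has_vector_derivative dx i t) (at t within {t0..})" if "i < n" "t0 \<le> t" for i t
    using sol that unfolding network_solution_def dx_def by blast
  have at: "(x i has_vector_derivative dx i t) (at t)" if "i < n" "t0 < t" for i t
  proof -
    have "at t within {t0..} = at t" using that(2) by (intro at_within_interior) simp
    then show ?thesis using within[OF that(1), of t] that(2) by simp
  qed
  have contx: "continuous_on {t0..} (x i)" if "i < n" for i
    unfolding continuous_on_eq_continuous_within
    by (intro ballI has_vector_derivative_continuous[OF within[OF that]]) simp
  have bl: "bounded_linear w" using w by (rule linear_conv_bounded_linear[THEN iffD1])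
  have contD: "continuous_on {t0..} D"
    unfolding D_def disagreement_def mean_def
    by (intro continuous_intros contx bounded_linear.continuous_on[OF bl]) auto
  have bound: "D b \<le> d / a + exp (- a * (b - t0)) * (D t0 - d / a)"
    if b: "t0 \<le> b" and good: "\<And>t i. t0 < t \<Longrightarrow> t < b \<Longrightarrow> i < n \<Longrightarrow> x i t \<in> ball p r"
      "\<And>t. t0 < t \<Longrightarrow> t < b \<Longrightarrow> D t < v" for b
  proof (rule linear_differential_inequality[OF b a])
    show "continuous_on {t0..b} D" by (rule continuous_on_subset[OF contD]) auto
    fix t assume t: "t0 < t" "t < b"
    have "(D has_real_derivative
        2 * (\<Sum>i<n. inner (w (x i t - mean n (\<lambda>i. x i t))) (w (dx i t)))) (at t)"
      unfolding D_def by (rule disagreement_has_derivative[OF n w at[OF _ t(1)]])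
    moreover have "2 * (\<Sum>i<n. inner (w (x i t - mean n (\<lambda>i. x i t))) (w (dx i t))) \<le> - a * D t + d"
      unfolding D_def dx_def
      by (rule decay[OF t(1) good(1)[OF t]]) (use good(2)[OF t] in \<open>simp_all only: D_def\<close>)
    ultimately show "\<exists>u'. (D has_real_derivative u') (at t) \<and> u' \<le> - a * D t + d" by blast
  qed
  have below: "d / a + exp (- a * (b - t0)) * (D t0 - d / a) < v" if "t0 \<le> b" for b
  proof (cases "d / a \<le> D t0")
    case True
    then have "exp (- a * (b - t0)) * (D t0 - d / a) \<le> 1 * (D t0 - d / a)"
      using a that by (intro mult_right_mono) auto
    then show ?thesis using start(2) by (simp add: D_def)
  next
    case False
    then have "exp (- a * (b - t0)) * (D t0 - d / a) \<le> 0" by (intro mult_nonneg_nonpos) auto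
    then show ?thesis using d by simp
  qed
  define bad where "bad = ({t0..} \<inter> D -` {v..}) \<union> (\<Union>i<n. {t0..} \<inter> x i -` (- ball p r))"
  have good_iff: "t \<notin> bad \<longleftrightarrow> D t < v \<and> (\<forall>i<n. x i t \<in> ball p r)" if "t0 \<le> t" for t
    using that by (auto simp: bad_def)
  have "bad = {}"
  proof (rule ccontr)
    assume ne: "bad \<noteq> {}"
    have "closed bad"
      unfolding bad_def
      by (intro closed_Un closed_UN ballI continuous_closed_preimage contD contx) auto
    moreover have bdd: "bdd_below bad" by (rule bdd_belowI[of _ t0]) (auto simp: bad_def)
    ultimately have inf: "Inf bad \<in> bad" using ne by (intro closed_contains_Inf)
    define b where "b = Inf bad"
    have "t0 \<notin> bad" using good_iff start by (simp add: D_def)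
    moreover have "t0 \<le> b" using inf by (auto simp: b_def bad_def)
    ultimately have b: "t0 < b" using inf unfolding b_def by (metis order_le_less)
    have good: "D t < v \<and> (\<forall>i<n. x i t \<in> ball p r)" if "t0 \<le> t" "t < b" for t
    proof -
      have "t \<notin> bad"
      proof
        assume "t \<in> bad"
        from cInf_lower[OF this bdd] that(2) show False by (simp add: b_def)
      qed
      then show ?thesis using good_iff[OF that(1)] by simp
    qed
    have "D b \<le> d / a + exp (- a * (b - t0)) * (D t0 - d / a)"
      by (rule bound) (use good b in auto)
    also have "\<dots> < v" using b by (intro below) simp
    finally have "D b < v" .
    with inf b obtain i where i: "i < n" "x i b \<notin> ball p r"
      using good_iff[of b] by (auto simp: b_def)
    then have exits: "\<not> (\<forall>i<n. \<forall>t\<ge>t0. x i t \<in> ball p r)" using b less_imp_le by blast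
    from confined have "\<exists>c>0. (\<forall>t. \<forall>x\<in>sphere p r. inner (f t x) (x - p) \<le> - c) \<and>
        (\<forall>t>t0. \<forall>i<n. (\<forall>i<n. x i t \<in> ball p r) \<longrightarrow> disagreement n w (\<lambda>i. x i t) < v \<longrightarrow>
          norm (g i t (x i t) + \<alpha> *\<^sub>R (\<Sum>j<n. W $$ (i, j) *\<^sub>R h (x j t - x i t))) * r \<le> c / 2)"
      by (rule disjE) (rule notE[OF exits])
    then obtain c where c: "0 < c"
      and inflow: "\<forall>t. \<forall>x\<in>sphere p r. inner (f t x) (x - p) \<le> - c"
      and small: "\<forall>t>t0. \<forall>i<n. (\<forall>i<n. x i t \<in> ball p r) \<longrightarrow> disagreement n w (\<lambda>i. x i t) < v \<longrightarrow>
          norm (g i t (x i t) + \<alpha> *\<^sub>R (\<Sum>j<n. W $$ (i, j) *\<^sub>R h (x j t - x i t))) * r \<le> c / 2"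
      by (elim exE conjE) (rule that)
    have "x i b \<in> ball p r"
    proof (rule inflow_prevents_exit[OF b r c f inflow[rule_format]])
      show "continuous_on {t0..b} (x i)" by (rule continuous_on_subset[OF contx[OF i(1)]]) auto
      fix t assume t: "t0 < t" "t < b"
      show "(x i has_vector_derivative f t (x i t) + (g i t (x i t)
          + \<alpha> *\<^sub>R (\<Sum>j<n. W $$ (i, j) *\<^sub>R h (x j t - x i t)))) (at t)"
        using at[OF i(1) t(1)] by (simp add: dx_def add.assoc)
      show "norm (g i t (x i t) + \<alpha> *\<^sub>R (\<Sum>j<n. W $$ (i, j) *\<^sub>R h (x j t - x i t))) * r \<le> c / 2"
        using small[rule_format, OF t(1) i(1)] good[of t] t unfolding D_def by simp
    qed (use good i in auto)
    then show False using i by simp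
  qed
  then have good: "D s < v \<and> (\<forall>i<n. x i s \<in> ball p r)" if "t0 \<le> s" for s
    using good_iff[OF that] by simp
  have "D t \<le> d / a + exp (- a * (t - t0)) * (D t0 - d / a)"
    by (rule bound[OF t]) (use good in auto)
  then show ?thesis by (simp only: D_def)
qed

section \<open>Networks near synchrony\<close>

lemma laplacian_entries:
  assumes "network n W"
  shows "laplacian n W \<in> carrier_mat n n"
    and "\<And>i j. i < n \<Longrightarrow> j < n \<Longrightarrow>
      laplacian n W $$ (i, j) = (if i = j then \<Sum>j<n. W $$ (i, j) else 0) - W $$ (i, j)"
    and "\<And>i. i < n \<Longrightarrow> (\<Sum>j<n. laplacian n W $$ (i, j)) = 0"
proof -
  have W: "W \<in> carrier_mat n n" using assms by (simp add: network_def)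
  then show "laplacian n W \<in> carrier_mat n n"
    by (auto simp: laplacian_def degree_matrix_def mat_diag_def intro: minus_carrier_mat)
  show entry: "laplacian n W $$ (i, j) = (if i = j then \<Sum>j<n. W $$ (i, j) else 0) - W $$ (i, j)"
    if "i < n" "j < n" for i j
    using W that by (simp add: laplacian_def degree_matrix_def mat_diag_def)
  show "(\<Sum>j<n. laplacian n W $$ (i, j)) = 0" if "i < n" for i
    using that by (simp add: entry sum_subtractf)
qed

text \<open>The eigenvalues of the Laplacian other than the first are positive reals, so the minimum over
  the products is the product of the minima as soon as \<open>\<beta>\<close> is positive; and it is positive, because
  \<open>\<beta>\<close> times the second eigenvalue is one of the products, none of which is below \<open>\<gamma>\<close>.\<close>

lemma gamma_min_eq:
  fixes \<Gamma> :: "real ^ 'm ^ 'm" and lam :: "nat \<Rightarrow> real"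
  assumes n: "2 \<le> n" and lam2: "0 < lam 2" and mono: "\<And>i. 2 \<le> i \<Longrightarrow> i \<le> n \<Longrightarrow> lam 2 \<le> lam i"
    and pos: "0 < gamma_min n (\<lambda>i. complex_of_real (lam i)) \<Gamma>"
  shows "0 < beta_min \<Gamma>" "gamma_min n (\<lambda>i. complex_of_real (lam i)) \<Gamma> = beta_min \<Gamma> * lam 2"
proof -
  note E = complex_eigenvalues_finite_nonempty[of \<Gamma>]
  define S where "S = (\<lambda>(i, b). Re (complex_of_real (lam i) * b)) ` ({2..n} \<times> complex_eigenvalues \<Gamma>)"
  have finS: "finite S" using E by (simp add: S_def)
  have "beta_min \<Gamma> \<in> Re ` complex_eigenvalues \<Gamma>"
    unfolding beta_min_def using E by (intro Min_in) auto
  then obtain b0 where b0: "b0 \<in> complex_eigenvalues \<Gamma>" "Re b0 = beta_min \<Gamma>" by auto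
  have mem: "beta_min \<Gamma> * lam 2 \<in> S"
    unfolding S_def by (rule image_eqI[of _ _ "(2, b0)"]) (use n b0 in auto)
  have "gamma_min n (\<lambda>i. complex_of_real (lam i)) \<Gamma> \<le> beta_min \<Gamma> * lam 2"
    unfolding gamma_min_def S_def[symmetric] by (rule Min_le[OF finS mem])
  with pos have "0 < beta_min \<Gamma> * lam 2" by linarith
  then show \<beta>: "0 < beta_min \<Gamma>" using lam2 by (simp add: zero_less_mult_iff)
  show "gamma_min n (\<lambda>i. complex_of_real (lam i)) \<Gamma> = beta_min \<Gamma> * lam 2"
    unfolding gamma_min_def S_def[symmetric]
  proof (rule Min_eqI[OF finS _ mem])
    fix s assume "s \<in> S"
    then obtain i b where ib: "2 \<le> i" "i \<le> n" "b \<in> complex_eigenvalues \<Gamma>" "s = lam i * Re b"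
      by (auto simp: S_def)
    have "beta_min \<Gamma> \<le> Re b" unfolding beta_min_def using E ib(3) by (intro Min_le) auto
    then have "beta_min \<Gamma> * lam 2 \<le> Re b * lam i"
      using \<beta> lam2 mono[OF ib(1,2)] by (intro mult_mono) auto
    then show "beta_min \<Gamma> * lam 2 \<le> s" using ib(4) by (simp add: mult.commute)
  qed
qed

lemma coupling_remainder:
  fixes h :: "real ^ 'm \<Rightarrow> real ^ 'm"
  assumes "assumption_A2 h \<Gamma>" and "0 < \<eta>"
  obtains \<sigma> where "0 < \<sigma>" "\<And>z. norm z < \<sigma> \<Longrightarrow> norm (h z - \<Gamma> *v z) \<le> \<eta> * norm z"
proof -
  have "(h has_derivative (\<lambda>v. \<Gamma> *v v)) (at 0)" "h 0 = 0"
    using assms(1) by (auto simp: assumption_A2_def)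
  then show thesis using that assms(2) unfolding has_derivative_at_alt by (metis diff_zero)
qed

text \<open>Half of the inflow is divided between the perturbation and the coupling term: the latter is small
  when neighbouring nodes are close, since \<open>h\<close> vanishes at zero.\<close>

lemma inflow_margin:
  fixes h :: "real ^ 'm \<Rightarrow> real ^ 'm"
  assumes h: "assumption_A2 h \<Gamma>" and r: "0 < r" and A: "0 \<le> A"
  obtains \<sigma> \<epsilon> where "0 < \<sigma>" "0 < \<epsilon>"
    "uniformly_inflowing f p r \<Longrightarrow> \<exists>c>0. (\<forall>t. \<forall>x\<in>sphere p r. inner (f t x) (x - p) \<le> - c) \<and>
      \<epsilon> * r \<le> c / 4 \<and> (\<forall>z. norm z < \<sigma> \<longrightarrow> A * norm (h z) * r \<le> c / 4)"
proof (cases "uniformly_inflowing f p r")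
  case True
  then obtain c where c: "0 < c" "\<forall>t. \<forall>x\<in>sphere p r. inner (f t x) (x - p) \<le> - c"
    by (auto simp: uniformly_inflowing_def)
  define B where "B = A + 1"
  have B: "0 < B" "A \<le> B" using A by (auto simp: B_def)
  define \<theta> where "\<theta> = c / (4 * B * r)"
  have \<theta>: "0 < \<theta>" using c r B by (simp add: \<theta>_def)
  have "h 0 = 0" "(h has_derivative (\<lambda>v. \<Gamma> *v v)) (at 0)"
    using h by (auto simp: assumption_A2_def)
  then have "(h \<longlongrightarrow> 0) (at 0)" using has_derivative_continuous isCont_def by metis
  then obtain \<sigma> where \<sigma>: "0 < \<sigma>" "\<And>z. z \<noteq> 0 \<Longrightarrow> norm z < \<sigma> \<Longrightarrow> norm (h z) < \<theta>"
    using \<theta> by (auto simp: tendsto_iff eventually_at)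
  have "A * norm (h z) * r \<le> c / 4" if z: "norm z < \<sigma>" for z
  proof -
    have "norm (h z) \<le> \<theta>" using \<sigma>(2)[of z] z \<open>h 0 = 0\<close> \<theta> by (cases "z = 0") auto
    then have "A * norm (h z) * r \<le> B * \<theta> * r"
      using A B r \<theta> by (intro mult_right_mono mult_mono) auto
    also have "\<dots> = c / 4" using B r by (simp add: \<theta>_def)
    finally show ?thesis .
  qed
  with c r show thesis by (intro that[of \<sigma> "c / (4 * r)"] \<sigma>(1)) auto
next
  case False
  then show thesis by (intro that[of 1 1]) auto
qed

lemma coupling_norm_le:
  fixes h :: "'a :: real_normed_vector \<Rightarrow> 'b :: real_normed_vector" and z :: "nat \<Rightarrow> 'a"
  assumes i: "i < n" and \<alpha>: "0 \<le> \<alpha>" and r: "0 \<le> r"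
    and h: "\<And>j. j < n \<Longrightarrow> \<alpha> * (\<Sum>i<n. \<Sum>j<n. \<bar>W $$ (i, j)\<bar>) * norm (h (z j)) * r \<le> b"
    and b: "0 \<le> b"
  shows "norm (\<alpha> *\<^sub>R (\<Sum>j<n. W $$ (i, j) *\<^sub>R h (z j))) * r \<le> b"
proof -
  define m where "m = Max ((\<lambda>j. norm (h (z j))) ` {..<n})"
  have ne: "(\<lambda>j. norm (h (z j))) ` {..<n} \<noteq> {}" using i by auto
  have le: "norm (h (z j)) \<le> m" if "j < n" for j
    unfolding m_def using that by (intro Max_ge) auto
  have "m \<in> (\<lambda>j. norm (h (z j))) ` {..<n}" unfolding m_def by (intro Max_in ne) auto
  then obtain l where l: "l < n" "m = norm (h (z l))" by auto
  have "norm (\<Sum>j<n. W $$ (i, j) *\<^sub>R h (z j)) \<le> (\<Sum>j<n. \<bar>W $$ (i, j)\<bar> * m)"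
    by (rule sum_norm_le) (simp add: le mult_left_mono)
  also have "\<dots> = (\<Sum>j<n. \<bar>W $$ (i, j)\<bar>) * m" by (simp add: sum_distrib_right)
  also have "\<dots> \<le> (\<Sum>i<n. \<Sum>j<n. \<bar>W $$ (i, j)\<bar>) * m"
    using i l(2) by (intro mult_right_mono member_le_sum[of i _ "\<lambda>i. \<Sum>j<n. \<bar>W $$ (i, j)\<bar>"])
      (auto intro: sum_nonneg)
  finally have "\<alpha> * norm (\<Sum>j<n. W $$ (i, j) *\<^sub>R h (z j)) * r
      \<le> \<alpha> * ((\<Sum>i<n. \<Sum>j<n. \<bar>W $$ (i, j)\<bar>) * m) * r"
    using \<alpha> r by (intro mult_right_mono mult_left_mono)
  also have "\<dots> \<le> b" using h[OF l(1)] l(2) by (simp add: mult.assoc)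
  finally show ?thesis using \<alpha> by simp
qed

lemma Limsup_le_of_tendsto:
  fixes u v :: "real \<Rightarrow> real"
  assumes "eventually (\<lambda>t. u t \<le> v t) at_top" and "(v \<longlongrightarrow> l) at_top"
  shows "Limsup at_top (\<lambda>t. ereal (u t)) \<le> ereal l"
proof -
  have "Limsup at_top (\<lambda>t. ereal (u t)) \<le> Limsup at_top (\<lambda>t. ereal (v t))"
    using assms(1) by (intro Limsup_mono) (auto elim: eventually_mono)
  also have "\<dots> = ereal l"
    using assms(2) by (intro lim_imp_Limsup) (auto intro: tendsto_ereal)
  finally show ?thesis .
qed

text \<open>All bounds on \<open>\<delta>\<close> and \<open>\<epsilon>g\<close> come from keeping the disagreement below the threshold \<open>v\<close>, under which
  any two nodes are closer than \<open>\<sigma>\<close>; they may depend on the network. The final bound does not: the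
  disagreement tends to at most \<open>2 * n * (k2 * \<epsilon> / a)\<^sup>2\<close>, and the average error to a fixed multiple of the root
  of its \<open>n\<close>-th part.\<close>

lemma network_error_limsup:
  fixes \<Gamma> T :: "_ ^ 'm ^ 'm" and w :: "real ^ 'm \<Rightarrow> complex ^ 'm" and lam :: "nat \<Rightarrow> real"
  assumes w: "linear w" and k1: "0 < k1" and low: "\<And>v. k1 * norm v \<le> norm (w v)"
    and k2: "0 < k2" and up: "\<And>v. norm (w v) \<le> k2 * norm v"
    and T: "\<And>v. w (\<Gamma> *v v) = T *v w v"
    and diag: "\<And>k. \<beta> \<le> Re (T $ k $ k)"
    and off: "\<And>k l. k \<noteq> l \<Longrightarrow> cmod (T $ k $ l) \<le> \<eta>0"
    and \<eta>0: "0 \<le> \<eta>0" "real CARD('m) * \<eta>0 \<le> \<beta> / 2"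
    and f: "continuous_on UNIV (\<lambda>(t, x). f t x)" and r: "0 < r" and lip0: "0 \<le> lip"
    and lip: "\<And>t x y. x \<in> ball p r \<Longrightarrow> y \<in> ball p r \<Longrightarrow> norm (f t x - f t y) \<le> lip * norm (x - y)"
    and net: "network n W" and sym: "transpose_mat (laplacian n W) = laplacian n W"
    and spec: "laplacian_spectrum n (laplacian n W) (\<lambda>i. complex_of_real (lam i))"
    and lam2: "0 < lam 2" and mono: "\<And>i. 2 \<le> i \<Longrightarrow> i \<le> n \<Longrightarrow> lam 2 \<le> lam i"
    and h: "assumption_A2 h \<Gamma>" and \<alpha>: "0 < \<alpha>"
    and a: "a = \<alpha> * (\<beta> / 2 * lam 2) - k2 / k1 * lip" "0 < a"
  obtains \<delta> \<epsilon>g where "0 < \<delta>" "0 < \<epsilon>g"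
    "\<And>g \<epsilon> t0 x. \<epsilon> \<le> \<epsilon>g \<Longrightarrow> small_perturbation p r n g \<epsilon> \<Longrightarrow>
      near_sync_solution f p r g n W h \<alpha> \<delta> t0 x \<Longrightarrow>
      Limsup at_top (\<lambda>t. ereal (average_sync_error n x t)) \<le> ereal (8 * k2 * \<epsilon> / (k1 * a))"
proof -
  define L where "L = laplacian n W"
  have n2: "2 \<le> n" using net by (simp add: network_def)
  then have n: "0 < n" by simp
  note L = laplacian_entries[OF net, folded L_def]
  have symL: "L $$ (i, j) = L $$ (j, i)" if "i < n" "j < n" for i j
  proof -
    have "L $$ (i, j) = transpose_mat L $$ (i, j)" using sym by (simp add: L_def)
    then show ?thesis using that L(1) by simp
  qed
  have gap: "lam 2 * (\<Sum>i<n. (v i)\<^sup>2) \<le> qform n L v v" if "(\<Sum>i<n. v i) = 0" for v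
    by (rule spectral_gap[OF n2 L(1) symL L(3) spec[folded L_def] lam2 mono that])
  have coercive: "\<beta> / 2 * lam 2 * disagreement n w y
      \<le> (\<Sum>i<n. \<Sum>j<n. L $$ (i, j) * inner (w (y i - mean n y)) (w (\<Gamma> *v (y j - mean n y))))" for y
  proof -
    have "(\<Sum>i<n. w (y i - mean n y)) = 0"
      using sum_diff_mean[OF n, of y] linear_0[OF w] by (simp flip: linear_sum[OF w])
    from coupling_coercive[OF symL gap less_imp_le[OF lam2] diag off \<eta>0(2,1) this]
    show ?thesis by (simp add: disagreement_def T)
  qed
  define M where "M = (\<Sum>i<n. \<Sum>j<n. \<bar>W $$ (i, j)\<bar>)"
  have M: "0 \<le> M" by (auto simp: M_def intro!: sum_nonneg)
  define N where "N = M + 1"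
  have N: "0 < N" "M \<le> N" using M by (auto simp: N_def)
  \<comment> \<open>Chosen so that the nonlinear part of the coupling consumes a quarter of the rate \<open>a\<close>.\<close>
  define \<eta> where "\<eta> = a * k1 / (8 * \<alpha> * k2 * N)"
  have \<eta>: "0 < \<eta>" using a(2) k1 k2 \<alpha> N by (simp add: \<eta>_def)
  have \<eta>_small: "\<alpha> * k2 * \<eta> / k1 * 2 * M \<le> a / 4"
  proof -
    have "\<alpha> * k2 * \<eta> / k1 * 2 * M = a / 4 * (M / N)"
      using k1 k2 \<alpha> N by (simp add: \<eta>_def)
    also have "\<dots> \<le> a / 4 * 1" using a(2) M N by (intro mult_left_mono) auto
    finally show ?thesis by simp
  qed
  obtain \<sigma>1 where \<sigma>1: "0 < \<sigma>1" and rem: "\<And>z. norm z < \<sigma>1 \<Longrightarrow> norm (h z - \<Gamma> *v z) \<le> \<eta> * norm z"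
    by (rule coupling_remainder[OF h \<eta>]) blast
  have \<alpha>M: "0 \<le> \<alpha> * M" using \<alpha> M by simp
  obtain \<sigma>2 \<epsilon>1 where \<sigma>2: "0 < \<sigma>2" and \<epsilon>1: "0 < \<epsilon>1"
    and margin: "uniformly_inflowing f p r \<Longrightarrow> \<exists>c>0. (\<forall>t. \<forall>x\<in>sphere p r. inner (f t x) (x - p) \<le> - c) \<and>
      \<epsilon>1 * r \<le> c / 4 \<and> (\<forall>z. norm z < \<sigma>2 \<longrightarrow> \<alpha> * M * norm (h z) * r \<le> c / 4)"
    by (rule inflow_margin[OF h r \<alpha>M, of f p]) blast
  define \<sigma> where "\<sigma> = min \<sigma>1 \<sigma>2"
  define s where "s = k1 * \<sigma> / 4"
  have s: "0 < s" using k1 \<sigma>1 \<sigma>2 by (simp add: s_def \<sigma>_def)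
  define v where "v = s\<^sup>2"
  have v: "0 < v" using s by (simp add: v_def)
  \<comment> \<open>With initial distances at most \<open>q\<close> the disagreement starts at no more than \<open>v / 4\<close>; with perturbations
    of size at most \<open>a * q\<close> its asymptotic bound is at most \<open>v / 2\<close>.\<close>
  define q where "q = s / (2 * sqrt (real n) * k2)"
  have q: "0 < q" using s n k2 by (simp add: q_def)
  have q_sq: "real n * k2\<^sup>2 * q\<^sup>2 = v / 4"
    using n k2 by (simp add: q_def v_def power_divide power_mult_distrib field_simps)
  have close: "norm (y i - y j) < \<sigma>" if "disagreement n w y < v" "i < n" "j < n" for y i j
  proof -
    have "sqrt (disagreement n w y) \<le> s"
      using that(1) s by (intro real_le_lsqrt) (auto simp: v_def)
    then have "2 / k1 * sqrt (disagreement n w y) \<le> 2 / k1 * s"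
      using k1 by (intro mult_left_mono) auto
    also have "\<dots> = \<sigma> / 2" using k1 by (simp add: s_def)
    also have "\<dots> < \<sigma>" using s k1 by (simp add: s_def zero_less_mult_iff)
    finally show ?thesis
      using pairwise_le_disagreement[OF k1 low that(2,3), of y] by linarith
  qed
  define \<epsilon>g where "\<epsilon>g = min \<epsilon>1 (a * q)"
  show thesis
  proof (rule that[of q \<epsilon>g])
    show "0 < q" by (rule q)
    show "0 < \<epsilon>g" using \<epsilon>1 a(2) q by (simp add: \<epsilon>g_def)
    fix g \<epsilon> t0 x
    assume \<epsilon>: "\<epsilon> \<le> \<epsilon>g" and pert: "small_perturbation p r n g \<epsilon>"
      and near: "near_sync_solution f p r g n W h \<alpha> q t0 x"
    have sol: "network_solution f g n W h \<alpha> t0 x"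
      and start: "\<And>i. i < n \<Longrightarrow> x i t0 \<in> ball p r"
      and dist: "\<And>i j. i < n \<Longrightarrow> j < n \<Longrightarrow> norm (x i t0 - x j t0) \<le> q"
      and stay: "uniformly_inflowing f p r \<or> (\<forall>i<n. \<forall>t\<ge>t0. x i t \<in> ball p r)"
      using near unfolding near_sync_solution_def by blast+
    have noise: "norm (g i t y) \<le> \<epsilon>" if "i < n" "y \<in> ball p r" for i t y
      using pert that unfolding small_perturbation_def by blast
    have \<epsilon>_nonneg: "0 \<le> \<epsilon>" using noise[OF n start[OF n], of t0] by (meson norm_ge_zero order_trans)
    define D where "D t = disagreement n w (\<lambda>i. x i t)" for t
    define d where "d = 2 * real n * k2\<^sup>2 * \<epsilon>\<^sup>2 / a"
    have "D t0 \<le> real n * (k2 * q)\<^sup>2"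
      unfolding D_def using k2 by (intro disagreement_le_pairwise[OF n up _ dist]) auto
    then have D0: "D t0 < v" using q_sq v by (simp add: power_mult_distrib)
    have d_less: "d / a < v"
    proof -
      have "\<epsilon> \<le> a * q" using \<epsilon> by (simp add: \<epsilon>g_def)
      then have "\<epsilon>\<^sup>2 \<le> (a * q)\<^sup>2" using \<epsilon>_nonneg by (intro power_mono)
      then have "2 * (real n * k2\<^sup>2 * \<epsilon>\<^sup>2) \<le> 2 * (real n * k2\<^sup>2 * (a * q)\<^sup>2)"
        by (intro mult_left_mono) auto
      also have "\<dots> = 2 * (real n * k2\<^sup>2 * q\<^sup>2) * a\<^sup>2" by (simp add: power_mult_distrib)
      also have "\<dots> = v / 2 * a\<^sup>2" by (simp add: q_sq)
      finally have "d / a \<le> v / 2" using a(2) by (simp add: d_def field_simps power2_eq_square)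
      then show ?thesis using v by linarith
    qed
    have decay: "2 * (\<Sum>i<n. inner (w (x i t - mean n (\<lambda>i. x i t)))
        (w (f t (x i t) + g i t (x i t) + \<alpha> *\<^sub>R (\<Sum>j<n. W $$ (i, j) *\<^sub>R h (x j t - x i t)))))
      \<le> - a * disagreement n w (\<lambda>i. x i t) + d"
      if inside: "\<And>i. i < n \<Longrightarrow> x i t \<in> ball p r" and small: "disagreement n w (\<lambda>i. x i t) < v" for t
      unfolding d_def
    proof (rule disagreement_dissipation[OF n w matrix_vector_mul_linear[of \<Gamma>] k1 low _ up
          _ _ lip0 L(2) coercive _ _ _ a \<eta>_small[unfolded M_def]])
      show "norm (f t (x i t) - f t (mean n (\<lambda>i. x i t))) \<le> lip * norm (x i t - mean n (\<lambda>i. x i t))"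
        if "i < n" for i
        by (rule lip[OF inside[OF that] mean_in_ball[OF n inside]])
      show "norm (g i t (x i t)) \<le> \<epsilon>" if "i < n" for i
        by (rule noise[OF that inside[OF that]])
      show "norm (h (x j t - x i t) - \<Gamma> *v (x j t - x i t)) \<le> \<eta> * norm (x j t - x i t)"
        if "i < n" "j < n" for i j
        using close[OF small that(2,1)] by (intro rem) (simp add: \<sigma>_def)
    qed (use k2 \<alpha> \<eta> in auto)
    have confined: "(\<forall>i<n. \<forall>t\<ge>t0. x i t \<in> ball p r) \<or>
      (\<exists>c>0. (\<forall>t. \<forall>x\<in>sphere p r. inner (f t x) (x - p) \<le> - c) \<and>
        (\<forall>t>t0. \<forall>i<n. (\<forall>i<n. x i t \<in> ball p r) \<longrightarrow> disagreement n w (\<lambda>i. x i t) < v \<longrightarrow>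
          norm (g i t (x i t) + \<alpha> *\<^sub>R (\<Sum>j<n. W $$ (i, j) *\<^sub>R h (x j t - x i t))) * r \<le> c / 2))"
      using stay
    proof
      assume "uniformly_inflowing f p r"
      from margin[OF this] obtain c where c: "0 < c"
        and inflow: "\<forall>t. \<forall>x\<in>sphere p r. inner (f t x) (x - p) \<le> - c"
        and \<epsilon>1c: "\<epsilon>1 * r \<le> c / 4"
        and hc: "\<forall>z. norm z < \<sigma>2 \<longrightarrow> \<alpha> * M * norm (h z) * r \<le> c / 4"
        by (elim exE conjE) (rule that)
      have "norm (g i t (x i t) + \<alpha> *\<^sub>R (\<Sum>j<n. W $$ (i, j) *\<^sub>R h (x j t - x i t))) * r \<le> c / 2"
        if i: "i < n" and inside: "\<forall>i<n. x i t \<in> ball p r"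
          and small: "disagreement n w (\<lambda>i. x i t) < v" for t i
      proof -
        have "norm (g i t (x i t)) * r \<le> \<epsilon>1 * r"
          using noise[OF i inside[rule_format, OF i], of t] \<epsilon> r
          by (intro mult_right_mono) (auto simp: \<epsilon>g_def)
        moreover have "norm (\<alpha> *\<^sub>R (\<Sum>j<n. W $$ (i, j) *\<^sub>R h (x j t - x i t))) * r \<le> c / 4"
        proof (rule coupling_norm_le[OF i])
          fix j assume j: "j < n"
          show "\<alpha> * (\<Sum>i<n. \<Sum>j<n. \<bar>W $$ (i, j)\<bar>) * norm (h (x j t - x i t)) * r \<le> c / 4"
            using hc[rule_format, of "x j t - x i t"] close[OF small j i]
            unfolding M_def by (simp add: \<sigma>_def)
        qed (use \<alpha> r c in auto)
        moreover have "norm (g i t (x i t) + \<alpha> *\<^sub>R (\<Sum>j<n. W $$ (i, j) *\<^sub>R h (x j t - x i t))) * r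
            \<le> norm (g i t (x i t)) * r + norm (\<alpha> *\<^sub>R (\<Sum>j<n. W $$ (i, j) *\<^sub>R h (x j t - x i t))) * r"
          unfolding distrib_right[symmetric] using r by (intro mult_right_mono norm_triangle_ineq) auto
        ultimately show ?thesis using \<epsilon>1c by linarith
      qed
      with c inflow show ?thesis by blast
    qed (rule disjI1)
    have bound: "D t \<le> d / a + exp (- a * (t - t0)) * (D t0 - d / a)" if "t0 \<le> t" for t
      unfolding D_def
      by (rule network_solution_trapped[OF n w r f sol start D0[unfolded D_def] a(2) d_less decay
            confined that])
    define u where "u t = 4 / k1 * sqrt ((d / a + exp (- a * (t - t0)) * (D t0 - d / a)) / real n)" for t
    have "average_sync_error n x t \<le> u t" if "t0 \<le> t" for t
    proof -
      have "average_sync_error n x t \<le> 4 / k1 * sqrt (D t / real n)"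
        unfolding D_def by (rule average_sync_error_le[OF n2 k1 low])
      also have "\<dots> \<le> u t"
        unfolding u_def using bound[OF that] k1
        by (intro mult_left_mono real_sqrt_le_mono divide_right_mono) auto
      finally show ?thesis .
    qed
    then have "eventually (\<lambda>t. average_sync_error n x t \<le> u t) at_top"
      by (intro eventually_mono[OF eventually_ge_at_top[of t0]])
    moreover have "(u \<longlongrightarrow> 4 / k1 * sqrt ((d / a + 0 * (D t0 - d / a)) / real n)) at_top"
      unfolding u_def
    proof (intro tendsto_intros)
      show "((\<lambda>t. exp (- a * (t - t0))) \<longlongrightarrow> 0) at_top" using a(2) by real_asymp
    qed (use n in auto)
    ultimately have "Limsup at_top (\<lambda>t. ereal (average_sync_error n x t))
        \<le> ereal (4 / k1 * sqrt ((d / a + 0 * (D t0 - d / a)) / real n))"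
      by (rule Limsup_le_of_tendsto)
    also have "4 / k1 * sqrt ((d / a + 0 * (D t0 - d / a)) / real n) \<le> 8 * k2 * \<epsilon> / (k1 * a)"
    proof -
      have "(d / a + 0 * (D t0 - d / a)) / real n = 2 * (k2 * \<epsilon> / a)\<^sup>2"
        using n by (simp add: d_def power_mult_distrib power_divide power2_eq_square)
      also have "\<dots> \<le> (2 * (k2 * \<epsilon> / a))\<^sup>2"
        unfolding power_mult_distrib[of 2 "k2 * \<epsilon> / a"] by (intro mult_right_mono) auto
      finally have "sqrt ((d / a + 0 * (D t0 - d / a)) / real n) \<le> 2 * (k2 * \<epsilon> / a)"
        using k2 \<epsilon>_nonneg a(2) by (intro real_le_lsqrt) auto
      then have "4 / k1 * sqrt ((d / a + 0 * (D t0 - d / a)) / real n) \<le> 4 / k1 * (2 * (k2 * \<epsilon> / a))"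
        using k1 by (intro mult_left_mono) auto
      then show ?thesis by simp
    qed
    finally show "Limsup at_top (\<lambda>t. ereal (average_sync_error n x t)) \<le> ereal (8 * k2 * \<epsilon> / (k1 * a))"
      by simp
  qed
qed

section \<open>Monotonicity of the constants\<close>

text \<open>A larger constant weakens the claimed decay rate and strengthens the condition on the coupling
  strength. Hence the constant may be enlarged to dominate any quantity that depends only on \<open>f\<close>
  and \<open>\<Gamma>\<close>, which is what lets the synchronisation constant serve in the estimate of the error.\<close>

lemma sync_constant_mono:
  assumes sync: "sync_constant \<Gamma> f p r \<rho>'" and le: "\<rho>' \<le> \<rho>"
  shows "sync_constant \<Gamma> f p r \<rho>"
  unfolding sync_constant_def
proof (intro allI)
  fix n L
  obtain C where C: "0 < C" and est: "\<forall>W lam h \<alpha>.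
      network n W \<and> laplacian n W = L \<and> laplacian_spectrum n L lam \<and> assumption_A2 h \<Gamma> \<and>
        0 < gamma_min n lam \<Gamma> \<and> \<alpha> > \<rho>' / gamma_min n lam \<Gamma> \<longrightarrow>
        (\<exists>\<delta>>0. \<forall>t0 x. near_sync_solution f p r (\<lambda>_ _ _. 0) n W h \<alpha> \<delta> t0 x \<longrightarrow>
           (\<forall>i<n. \<forall>j<n. \<forall>t\<ge>t0. norm (x i t - x j t) \<le>
              C * exp (- (\<alpha> * gamma_min n lam \<Gamma> - \<rho>') * (t - t0)) * spread n x t0))"
    using sync[unfolded sync_constant_def, THEN spec[of _ n], THEN spec[of _ L]]
    by (elim exE conjE) (rule that)
  show "\<exists>C>0. \<forall>W lam h \<alpha>.
        network n W \<and> laplacian n W = L \<and> laplacian_spectrum n L lam \<and> assumption_A2 h \<Gamma> \<and>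
        0 < gamma_min n lam \<Gamma> \<and> \<alpha> > \<rho> / gamma_min n lam \<Gamma> \<longrightarrow>
        (\<exists>\<delta>>0. \<forall>t0 x. near_sync_solution f p r (\<lambda>_ _ _. 0) n W h \<alpha> \<delta> t0 x \<longrightarrow>
           (\<forall>i<n. \<forall>j<n. \<forall>t\<ge>t0. norm (x i t - x j t) \<le>
              C * exp (- (\<alpha> * gamma_min n lam \<Gamma> - \<rho>) * (t - t0)) * spread n x t0))"
  proof (rule exI[of _ C], rule conjI[OF C], intro allI impI, elim conjE)
    fix W lam h \<alpha>
    assume H: "network n W" "laplacian n W = L" "laplacian_spectrum n L lam" "assumption_A2 h \<Gamma>"
      "0 < gamma_min n lam \<Gamma>" "\<rho> / gamma_min n lam \<Gamma> < \<alpha>"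
    have "\<rho>' / gamma_min n lam \<Gamma> \<le> \<rho> / gamma_min n lam \<Gamma>"
      using H(5) le by (intro divide_right_mono) auto
    with H(6) have less: "\<rho>' / gamma_min n lam \<Gamma> < \<alpha>" by linarith
    obtain \<delta> where \<delta>: "0 < \<delta>" and est': "\<forall>t0 x.
        near_sync_solution f p r (\<lambda>_ _ _. 0) n W h \<alpha> \<delta> t0 x \<longrightarrow>
           (\<forall>i<n. \<forall>j<n. \<forall>t\<ge>t0. norm (x i t - x j t) \<le>
              C * exp (- (\<alpha> * gamma_min n lam \<Gamma> - \<rho>') * (t - t0)) * spread n x t0)"
      using est[THEN spec[of _ W], THEN spec[of _ lam], THEN spec[of _ h], THEN spec[of _ \<alpha>],
          THEN mp, OF conjI[OF H(1) conjI[OF H(2) conjI[OF H(3) conjI[OF H(4) conjI[OF H(5) less]]]]]]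
      by (elim exE conjE) (rule that)
    show "\<exists>\<delta>>0. \<forall>t0 x. near_sync_solution f p r (\<lambda>_ _ _. 0) n W h \<alpha> \<delta> t0 x \<longrightarrow>
           (\<forall>i<n. \<forall>j<n. \<forall>t\<ge>t0. norm (x i t - x j t) \<le>
              C * exp (- (\<alpha> * gamma_min n lam \<Gamma> - \<rho>) * (t - t0)) * spread n x t0)"
    proof (rule exI[of _ \<delta>], rule conjI[OF \<delta>], intro allI impI)
      fix t0 x i j t
      assume sol: "near_sync_solution f p r (\<lambda>_ _ _. 0) n W h \<alpha> \<delta> t0 x"
        and ij: "i < n" "j < n" and t: "t0 \<le> t"
      have "norm (x i t0 - x i t0) \<le> spread n x t0"
        unfolding spread_def using ij(1) by (intro Max_ge image_eqI[of _ _ "(i, i)"]) auto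
      then have sp: "0 \<le> spread n x t0" by simp
      have "(- (\<alpha> * gamma_min n lam \<Gamma> - \<rho>')) * (t - t0) \<le> (- (\<alpha> * gamma_min n lam \<Gamma> - \<rho>)) * (t - t0)"
        using le t by (intro mult_right_mono) auto
      then have "C * exp (- (\<alpha> * gamma_min n lam \<Gamma> - \<rho>') * (t - t0)) * spread n x t0
          \<le> C * exp (- (\<alpha> * gamma_min n lam \<Gamma> - \<rho>) * (t - t0)) * spread n x t0"
        using C sp by (intro mult_right_mono mult_left_mono) auto
      with est'[rule_format, OF sol ij t]
      show "norm (x i t - x j t)
          \<le> C * exp (- (\<alpha> * gamma_min n lam \<Gamma> - \<rho>) * (t - t0)) * spread n x t0"
        by (rule order_trans)
    qed
  qed
qed

lemma near_sync_solution_mono: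
  assumes "near_sync_solution f p r g n W h \<alpha> \<delta> t0 x" "\<delta> \<le> \<delta>'"
  shows "near_sync_solution f p r g n W h \<alpha> \<delta>' t0 x"
proof -
  have "\<forall>i<n. \<forall>j<n. norm (x i t0 - x j t0) \<le> \<delta>'"
    using assms(1) order_trans[OF _ assms(2)] unfolding near_sync_solution_def by blast
  with assms(1) show ?thesis unfolding near_sync_solution_def by (elim conjE) (intro conjI; assumption)
qed

lemma persistence_constants_mono:
  assumes pc: "persistence_constants f p r n W h \<alpha> \<mu> \<delta>' \<epsilon>'"
    and \<delta>: "0 < \<delta>" "\<delta> \<le> \<delta>'" and \<epsilon>: "0 < \<epsilon>" "\<epsilon> \<le> \<epsilon>'"
  shows "persistence_constants f p r n W h \<alpha> \<mu> \<delta> \<epsilon>"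
proof -
  obtain C where C: "0 < C" and est: "\<forall>g \<epsilon>0 t0 x.
        \<epsilon>0 \<le> \<epsilon>' \<and> small_perturbation p r n g \<epsilon>0 \<and>
        near_sync_solution f p r g n W h \<alpha> \<delta>' t0 x \<longrightarrow>
        (\<forall>i<n. \<forall>j<n. \<forall>t\<ge>t0. norm (x i t - x j t) \<le>
           C * exp (- \<mu> * (t - t0)) * spread n x t0 + C * \<epsilon>0 / \<mu>)"
    using pc unfolding persistence_constants_def by (elim exE conjE) (rule that)
  show ?thesis
    unfolding persistence_constants_def
  proof (intro conjI \<delta>(1) \<epsilon>(1), rule exI[of _ C], rule conjI[OF C], intro allI impI, elim conjE)
    fix g \<epsilon>0 t0 x i j t
    assume "\<epsilon>0 \<le> \<epsilon>" and pert: "small_perturbation p r n g \<epsilon>0"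
      and sol: "near_sync_solution f p r g n W h \<alpha> \<delta> t0 x" and ij: "i < n" "j < n" and t: "t0 \<le> t"
    then have le: "\<epsilon>0 \<le> \<epsilon>'" using \<epsilon>(2) by linarith
    show "norm (x i t - x j t) \<le> C * exp (- \<mu> * (t - t0)) * spread n x t0 + C * \<epsilon>0 / \<mu>"
      by (rule est[rule_format, OF conjI[OF le conjI[OF pert near_sync_solution_mono[OF sol \<delta>(2)]]] ij t])
  qed
qed

section \<open>The asymptotic bound on the average error\<close>

lemma ordered_eigenvalues_ge:
  fixes lam :: "nat \<Rightarrow> real"
  assumes ordered: "\<forall>i\<in>{2..<n}. lam i \<le> lam (Suc i)" and i: "2 \<le> i" "i \<le> n"
  shows "lam 2 \<le> lam i"
  using i
proof (induction i rule: dec_induct)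
  case (step i)
  then have "lam i \<le> lam (Suc i)" using ordered by simp
  with step show ?case by simp
qed simp

lemma assumption_A1_lipschitz:
  fixes f :: "real \<Rightarrow> real ^ 'm \<Rightarrow> real ^ 'm"
  assumes "assumption_A1 f p r"
  obtains lip where "0 \<le> lip" "\<And>t x y. x \<in> ball p r \<Longrightarrow> y \<in> ball p r \<Longrightarrow>
    norm (f t x - f t y) \<le> lip * norm (x - y)"
proof -
  obtain D2 :: "real \<Rightarrow> real ^ 'm \<Rightarrow> (real ^ 'm) \<Rightarrow>\<^sub>L (real ^ 'm)" and lip
    where der: "\<forall>t. \<forall>x\<in>ball p r. (f t has_derivative blinfun_apply (D2 t x)) (at x)"
      and bd: "\<forall>t. \<forall>x\<in>ball p r. norm (D2 t x) \<le> lip" and lip: "0 < lip"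
    using assms unfolding assumption_A1_def
    by (elim conjE exE) (rule that, assumption, assumption, assumption)
  have "norm (f t x - f t y) \<le> lip * norm (x - y)" if xy: "x \<in> ball p r" "y \<in> ball p r" for t x y
  proof (rule differentiable_bound[OF convex_ball _ _ xy])
    show "(f t has_derivative blinfun_apply (D2 t z)) (at z within ball p r)" if "z \<in> ball p r" for z
      by (rule has_derivative_at_withinI[OF der[rule_format, OF that]])
    show "onorm (blinfun_apply (D2 t z)) \<le> lip" if "z \<in> ball p r" for z
      using bd[rule_format, OF that] by (simp add: norm_blinfun.rep_eq)
  qed
  with lip show thesis by (intro that[of lip]) auto
qed

lemma sync_constant_above:
  obtains \<rho> where "b \<le> \<rho>" "(\<exists>\<rho>'. sync_constant \<Gamma> f p r \<rho>') \<longrightarrow> sync_constant \<Gamma> f p r \<rho>"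
proof (cases "\<exists>\<rho>'. sync_constant \<Gamma> f p r \<rho>'")
  case True
  then obtain \<rho>' where "sync_constant \<Gamma> f p r \<rho>'" ..
  then have "sync_constant \<Gamma> f p r (max b \<rho>')" by (rule sync_constant_mono) simp
  then show thesis by (intro that[of "max b \<rho>'"]) simp_all
next
  case False
  then show thesis by (intro that[of b]) simp_all
qed

theorem corollary3:
  fixes \<Gamma> :: "real ^ 'm ^ 'm"
  shows "\<exists>K :: real. \<forall>f p r. assumption_A1 f p r \<longrightarrow>
    (\<exists>\<rho> :: real.
      ((\<exists>\<rho>'. sync_constant \<Gamma> f p r \<rho>') \<longrightarrow> sync_constant \<Gamma> f p r \<rho>) \<and>
      (\<forall>(n :: nat) (W :: real mat) (lam :: nat \<Rightarrow> real) h (\<alpha> :: real) \<gamma> \<beta>.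
        network n W \<and> transpose_mat (laplacian n W) = laplacian n W \<and>
        laplacian_spectrum n (laplacian n W) (\<lambda>i. complex_of_real (lam i)) \<and>
        0 < lam 2 \<and> (\<forall>i\<in>{2..<n}. lam i \<le> lam (Suc i)) \<and>
        assumption_A2 h \<Gamma> \<and>
        \<gamma> = gamma_min n (\<lambda>i. complex_of_real (lam i)) \<Gamma> \<and> 0 < \<gamma> \<and> \<beta> = beta_min \<Gamma> \<and>
        \<alpha> * \<gamma> > \<rho> \<longrightarrow>
        \<alpha> * \<gamma> = \<alpha> * \<beta> * lam 2 \<and>
        (\<exists>\<delta>>0. \<exists>\<epsilon>g>0.
          ((\<exists>\<delta>' \<epsilon>'. persistence_constants f p r n W h \<alpha> (\<alpha> * \<gamma> - \<rho>) \<delta>' \<epsilon>') \<longrightarrow>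
             persistence_constants f p r n W h \<alpha> (\<alpha> * \<gamma> - \<rho>) \<delta> \<epsilon>g) \<and>
          (\<forall>g \<epsilon>0 t0 x.
            \<epsilon>0 \<le> \<epsilon>g \<and> small_perturbation p r n g \<epsilon>0 \<and>
            near_sync_solution f p r g n W h \<alpha> \<delta> t0 x \<longrightarrow>
            Limsup at_top (\<lambda>t. ereal (average_sync_error n x t))
              \<le> ereal (K * (\<epsilon>0 / (\<alpha> * \<beta> * lam 2 - \<rho>)))))))"
proof (cases "0 < beta_min \<Gamma>")
  case False
  \<comment> \<open>When \<open>\<beta>\<close> is not positive, neither is \<open>\<gamma>\<close>, so the bound on the error is vacuous.\<close>
  show ?thesis
  proof (rule exI[of _ 0], intro allI impI)
    fix f :: "real \<Rightarrow> real ^ 'm \<Rightarrow> real ^ 'm" and p r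
    obtain \<rho> where \<rho>: "(\<exists>\<rho>'. sync_constant \<Gamma> f p r \<rho>') \<longrightarrow> sync_constant \<Gamma> f p r \<rho>"
      by (rule sync_constant_above)
    have vacuous: "\<not> 0 < gamma_min n (\<lambda>i. complex_of_real (lam i)) \<Gamma>"
      if "\<forall>i\<in>{2..<n}. lam i \<le> lam (Suc i)" "network n W" "0 < lam 2" for n W and lam :: "nat \<Rightarrow> real"
      using gamma_min_eq(1)[of n lam \<Gamma>, OF _ that(3) ordered_eigenvalues_ge[of n lam, OF that(1)]]
        that(2) False
      by (auto simp: network_def)
    show "\<exists>\<rho> :: real.
      ((\<exists>\<rho>'. sync_constant \<Gamma> f p r \<rho>') \<longrightarrow> sync_constant \<Gamma> f p r \<rho>) \<and>
      (\<forall>(n :: nat) (W :: real mat) (lam :: nat \<Rightarrow> real) h (\<alpha> :: real) \<gamma> \<beta>.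
        network n W \<and> transpose_mat (laplacian n W) = laplacian n W \<and>
        laplacian_spectrum n (laplacian n W) (\<lambda>i. complex_of_real (lam i)) \<and>
        0 < lam 2 \<and> (\<forall>i\<in>{2..<n}. lam i \<le> lam (Suc i)) \<and>
        assumption_A2 h \<Gamma> \<and>
        \<gamma> = gamma_min n (\<lambda>i. complex_of_real (lam i)) \<Gamma> \<and> 0 < \<gamma> \<and> \<beta> = beta_min \<Gamma> \<and>
        \<alpha> * \<gamma> > \<rho> \<longrightarrow>
        \<alpha> * \<gamma> = \<alpha> * \<beta> * lam 2 \<and>
        (\<exists>\<delta>>0. \<exists>\<epsilon>g>0.
          ((\<exists>\<delta>' \<epsilon>'. persistence_constants f p r n W h \<alpha> (\<alpha> * \<gamma> - \<rho>) \<delta>' \<epsilon>') \<longrightarrow>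
             persistence_constants f p r n W h \<alpha> (\<alpha> * \<gamma> - \<rho>) \<delta> \<epsilon>g) \<and>
          (\<forall>g \<epsilon>0 t0 x.
            \<epsilon>0 \<le> \<epsilon>g \<and> small_perturbation p r n g \<epsilon>0 \<and>
            near_sync_solution f p r g n W h \<alpha> \<delta> t0 x \<longrightarrow>
            Limsup at_top (\<lambda>t. ereal (average_sync_error n x t))
              \<le> ereal(0 * (\<epsilon>0 / (\<alpha> * \<beta> * lam 2 - \<rho>))))))"
      by (rule exI[of _ \<rho>], rule conjI[OF \<rho>], intro allI impI, elim conjE, rule notE[OF vacuous])
        (assumption, assumption, assumption, simp)
  qed
next
  case True
  define \<beta> where "\<beta> = beta_min \<Gamma>"
  have \<beta>: "0 < \<beta>" using True by (simp add: \<beta>_def)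
  define \<eta> where "\<eta> = \<beta> / (2 * real CARD('m))"
  have \<eta>: "0 < \<eta>" "real CARD('m) * \<eta> \<le> \<beta> / 2" using \<beta> by (simp_all add: \<eta>_def)
  have \<beta>_le: "\<beta> \<le> Re z" if "z \<in> complex_eigenvalues \<Gamma>" for z
    unfolding \<beta>_def beta_min_def using that complex_eigenvalues_finite_nonempty[of \<Gamma>]
    by (intro Min_le) auto
  obtain w :: "real ^ 'm \<Rightarrow> complex ^ 'm" and T :: "complex ^ 'm ^ 'm" where w: "linear w" "inj w"
    and T: "\<And>v. w (\<Gamma> *v v) = T *v w v" and diag: "\<And>k. \<beta> \<le> Re (T $ k $ k)"
    and off: "\<And>k l. k \<noteq> l \<Longrightarrow> cmod (T $ k $ l) \<le> \<eta>"
    by (rule nearly_diagonal_coordinates[of \<Gamma> \<beta> \<eta>, OF \<beta>_le \<eta>(1)]) (assumption, blast)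
  obtain k1 where k1: "0 < k1" and low: "\<And>v. k1 * norm v \<le> norm (w v)"
    by (rule linear_inj_bounded_below_pos[OF w]) blast
  obtain k2 where k2: "0 < k2" and up: "\<And>v. norm (w v) \<le> k2 * norm v"
    using bounded_linear.pos_bounded[OF linear_conv_bounded_linear[THEN iffD1, OF w(1)]]
    by (metis mult.commute)
  show ?thesis
  proof (rule exI[of _ "16 * k2 / k1"], intro allI impI)
    fix f :: "real \<Rightarrow> real ^ 'm \<Rightarrow> real ^ 'm" and p r
    assume A1: "assumption_A1 f p r"
    note f = A1[unfolded assumption_A1_def, THEN conjunct1]
      and r = A1[unfolded assumption_A1_def, THEN conjunct2, THEN conjunct1]
    obtain lip where lip0: "0 \<le> lip" and lip: "\<And>t x y. x \<in> ball p r \<Longrightarrow> y \<in> ball p r \<Longrightarrow>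
        norm (f t x - f t y) \<le> lip * norm (x - y)"
      by (rule assumption_A1_lipschitz[OF A1]) blast
    define \<rho>1 where "\<rho>1 = 2 * (k2 / k1) * lip"
    have \<rho>1: "0 \<le> \<rho>1" using k1 k2 lip0 by (simp add: \<rho>1_def)
    obtain \<rho> where \<rho>: "\<rho>1 \<le> \<rho>"
      "(\<exists>\<rho>'. sync_constant \<Gamma> f p r \<rho>') \<longrightarrow> sync_constant \<Gamma> f p r \<rho>"
      by (rule sync_constant_above)
    show "\<exists>\<rho>. ((\<exists>\<rho>'. sync_constant \<Gamma> f p r \<rho>') \<longrightarrow> sync_constant \<Gamma> f p r \<rho>) \<and>
      (\<forall>(n :: nat) (W :: real mat) (lam :: nat \<Rightarrow> real) h (\<alpha> :: real) \<gamma> \<beta>.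
        network n W \<and> transpose_mat (laplacian n W) = laplacian n W \<and>
        laplacian_spectrum n (laplacian n W) (\<lambda>i. complex_of_real (lam i)) \<and>
        0 < lam 2 \<and> (\<forall>i\<in>{2..<n}. lam i \<le> lam (Suc i)) \<and>
        assumption_A2 h \<Gamma> \<and>
        \<gamma> = gamma_min n (\<lambda>i. complex_of_real (lam i)) \<Gamma> \<and> 0 < \<gamma> \<and> \<beta> = beta_min \<Gamma> \<and>
        \<alpha> * \<gamma> > \<rho> \<longrightarrow>
        \<alpha> * \<gamma> = \<alpha> * \<beta> * lam 2 \<and>
        (\<exists>\<delta>>0. \<exists>\<epsilon>g>0.
          ((\<exists>\<delta>' \<epsilon>'. persistence_constants f p r n W h \<alpha> (\<alpha> * \<gamma> - \<rho>) \<delta>' \<epsilon>') \<longrightarrow>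
             persistence_constants f p r n W h \<alpha> (\<alpha> * \<gamma> - \<rho>) \<delta> \<epsilon>g) \<and>
          (\<forall>g \<epsilon>0 t0 x.
            \<epsilon>0 \<le> \<epsilon>g \<and> small_perturbation p r n g \<epsilon>0 \<and>
            near_sync_solution f p r g n W h \<alpha> \<delta> t0 x \<longrightarrow>
            Limsup at_top (\<lambda>t. ereal (average_sync_error n x t))
              \<le> ereal (16 * k2 / k1 * (\<epsilon>0 / (\<alpha> * \<beta> * lam 2 - \<rho>))))))"
    proof (rule exI[of _ \<rho>], rule conjI[OF \<rho>(2)], intro allI impI, elim conjE)
      fix n W h \<alpha> \<gamma> \<beta>' and lam :: "nat \<Rightarrow> real"
      assume net: "network n W" and sym: "transpose_mat (laplacian n W) = laplacian n W"
        and spec: "laplacian_spectrum n (laplacian n W) (\<lambda>i. complex_of_real (lam i))"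
        and lam2: "0 < lam 2" and ordered: "\<forall>i\<in>{2..<n}. lam i \<le> lam (Suc i)"
        and h: "assumption_A2 h \<Gamma>"
        and \<gamma>: "\<gamma> = gamma_min n (\<lambda>i. complex_of_real (lam i)) \<Gamma>" "0 < \<gamma>"
        and \<beta>': "\<beta>' = beta_min \<Gamma>" and strong: "\<rho> < \<alpha> * \<gamma>"
      note mono = ordered_eigenvalues_ge[of n lam, OF ordered]
      have n2: "2 \<le> n" using net by (simp add: network_def)
      have \<gamma>_eq: "\<gamma> = \<beta> * lam 2"
        unfolding \<gamma>(1) \<beta>_def by (rule gamma_min_eq(2)[OF n2 lam2 mono \<gamma>(2)[unfolded \<gamma>(1)]])
      then have rate: "\<alpha> * \<gamma> = \<alpha> * \<beta>' * lam 2" by (simp add: \<beta>' \<beta>_def)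
      have "0 < \<alpha> * \<gamma>" using strong \<rho>(1) \<rho>1 by linarith
      then have \<alpha>: "0 < \<alpha>" using \<gamma>(2) by (simp add: zero_less_mult_iff)
      define a where "a = \<alpha> * (\<beta> / 2 * lam 2) - k2 / k1 * lip"
      \<comment> \<open>The coercivity constant is \<open>\<beta> / 2\<close> instead of \<open>\<beta>\<close>, so half of the rate is left, since \<open>\<rho>\<close> is at least \<open>\<rho>1\<close>;
        the constant \<open>K\<close> absorbs the factor.\<close>
      have a_ge: "(\<alpha> * \<gamma> - \<rho>) / 2 \<le> a"
      proof -
        have "\<alpha> * (\<beta> / 2 * lam 2) = \<alpha> * \<gamma> / 2" by (simp add: \<gamma>_eq)
        moreover have "k2 / k1 * lip = \<rho>1 / 2" by (simp add: \<rho>1_def)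
        ultimately have "a = \<alpha> * \<gamma> / 2 - \<rho>1 / 2" by (simp only: a_def)
        then show ?thesis using \<rho>(1) by (simp add: diff_divide_distrib)
      qed
      have "0 < (\<alpha> * \<gamma> - \<rho>) / 2" using strong by simp
      then have a: "0 < a" using a_ge by (rule less_le_trans)
      obtain \<delta>1 \<epsilon>1 where \<delta>1: "0 < \<delta>1" and \<epsilon>1: "0 < \<epsilon>1" and
        est: "\<And>g \<epsilon> t0 x. \<epsilon> \<le> \<epsilon>1 \<Longrightarrow> small_perturbation p r n g \<epsilon> \<Longrightarrow>
          near_sync_solution f p r g n W h \<alpha> \<delta>1 t0 x \<Longrightarrow>
          Limsup at_top (\<lambda>t. ereal (average_sync_error n x t)) \<le> ereal (8 * k2 * \<epsilon> / (k1 * a))"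
        by (rule network_error_limsup[OF w(1) k1 low k2 up T diag off less_imp_le[OF \<eta>(1)] \<eta>(2)
              f r lip0 lip net sym spec lam2 mono h \<alpha> a_def a]) (assumption | blast)+
      obtain \<delta> \<epsilon>g where \<delta>: "0 < \<delta>" "\<delta> \<le> \<delta>1" and \<epsilon>g: "0 < \<epsilon>g" "\<epsilon>g \<le> \<epsilon>1"
        and pers: "(\<exists>\<delta>' \<epsilon>'. persistence_constants f p r n W h \<alpha> (\<alpha> * \<gamma> - \<rho>) \<delta>' \<epsilon>') \<longrightarrow>
             persistence_constants f p r n W h \<alpha> (\<alpha> * \<gamma> - \<rho>) \<delta> \<epsilon>g"
      proof (cases "\<exists>\<delta>' \<epsilon>'. persistence_constants f p r n W h \<alpha> (\<alpha> * \<gamma> - \<rho>) \<delta>' \<epsilon>'")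
        case True
        then obtain \<delta>' \<epsilon>' where pc: "persistence_constants f p r n W h \<alpha> (\<alpha> * \<gamma> - \<rho>) \<delta>' \<epsilon>'"
          by blast
        then have pos: "0 < \<delta>'" "0 < \<epsilon>'" unfolding persistence_constants_def by blast+
        have "persistence_constants f p r n W h \<alpha> (\<alpha> * \<gamma> - \<rho>) (min \<delta>1 \<delta>') (min \<epsilon>1 \<epsilon>')"
          by (rule persistence_constants_mono[OF pc]) (use pos \<delta>1 \<epsilon>1 in auto)
        then show thesis
          by (intro that[of "min \<delta>1 \<delta>'" "min \<epsilon>1 \<epsilon>'"]) (use pos \<delta>1 \<epsilon>1 in auto)
      next
        case False
        then show thesis by (intro that[of \<delta>1 \<epsilon>1]) (use \<delta>1 \<epsilon>1 in auto)
      qed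
      have "Limsup at_top (\<lambda>t. ereal (average_sync_error n x t))
              \<le> ereal (16 * k2 / k1 * (\<epsilon> / (\<alpha> * \<beta>' * lam 2 - \<rho>)))"
        if small: "\<epsilon> \<le> \<epsilon>g" and pert: "small_perturbation p r n g \<epsilon>"
          and near: "near_sync_solution f p r g n W h \<alpha> \<delta> t0 x" for g \<epsilon> t0 x
      proof -
        have "norm (g 0 t0 p) \<le> \<epsilon>"
          using pert n2 r unfolding small_perturbation_def by force
        then have \<epsilon>_nonneg: "0 \<le> \<epsilon>" by (meson norm_ge_zero order_trans)
        have "Limsup at_top (\<lambda>t. ereal (average_sync_error n x t)) \<le> ereal (8 * k2 * \<epsilon> / (k1 * a))"
          using small \<epsilon>g(2) by (intro est[OF _ pert near_sync_solution_mono[OF near \<delta>(2)]]) simp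
        also have "8 * k2 * \<epsilon> / (k1 * a) \<le> 8 * k2 * \<epsilon> / (k1 * ((\<alpha> * \<gamma> - \<rho>) / 2))"
          using k1 k2 \<epsilon>_nonneg a_ge strong a
          by (intro divide_left_mono mult_left_mono mult_pos_pos mult_nonneg_nonneg) auto
        also have "\<dots> = 16 * k2 / k1 * (\<epsilon> / (\<alpha> * \<beta>' * lam 2 - \<rho>))" by (simp add: rate)
        finally show ?thesis by simp
      qed
      then show "\<alpha> * \<gamma> = \<alpha> * \<beta>' * lam 2 \<and>
        (\<exists>\<delta>>0. \<exists>\<epsilon>g>0.
          ((\<exists>\<delta>' \<epsilon>'. persistence_constants f p r n W h \<alpha> (\<alpha> * \<gamma> - \<rho>) \<delta>' \<epsilon>') \<longrightarrow>
             persistence_constants f p r n W h \<alpha> (\<alpha> * \<gamma> - \<rho>) \<delta> \<epsilon>g) \<and>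
          (\<forall>g \<epsilon>0 t0 x.
            \<epsilon>0 \<le> \<epsilon>g \<and> small_perturbation p r n g \<epsilon>0 \<and>
            near_sync_solution f p r g n W h \<alpha> \<delta> t0 x \<longrightarrow>
            Limsup at_top (\<lambda>t. ereal (average_sync_error n x t))
              \<le> ereal (16 * k2 / k1 * (\<epsilon>0 / (\<alpha> * \<beta>' * lam 2 - \<rho>)))))"
        by (intro conjI[OF rate] exI[of _ \<delta>] exI[of _ \<epsilon>g] conjI[OF \<delta>(1)] conjI[OF \<epsilon>g(1)] conjI[OF pers]
            allI impI) (elim conjE)
    qed
  qed
qed

end
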